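(* Let $M=M_N$ be positive integers with $M\le N$, $M\to\infty$ and $M/N\to0$ as $N\to\infty$. For each $N$, let $(\lambda_1,\ldots,\lambda_M)\in\mathbb{R}^M$ be random with joint density proportional to $$\prod_{i=1}^M\lambda_i^{2(N-M)}\prod_{1\le i<j\le M}|\lambda_i-\lambda_j|^2\prod_{i=1}^M e^{-N\lambda_i^2/2}$$ with respect to Lebesgue measure, all defined on a common probability space, and let $L_M=\frac1M\sum_{i=1}^M\delta_{\lambda_i}$. Let $\Theta_M>0$, with $\Theta_M\to0$, satisfy $M^2\log\Theta_M^{-2}=NM\Theta_M^2$, and set $$\mu_{\alpha,M}=\frac1M\sum_{i:\lambda_i\ge0}\delta_{\Theta_M^{-1}(\lambda_i-\sqrt2)},\qquad \mu_{\beta,M}=\frac1M\sum_{i:\lambda_i<0}\delta_{-\Theta_M^{-1}(\lambda_i+\sqrt2)}.$$ Then, almost surely, $\operatorname{mass}(\mu_{\alpha,M})\to\frac12$ and $\operatorname{mass}(\mu_{\beta,M})\to\frac12$ as $M\to\infty$. Moreover, almost surely, $L_M$ converges weakly to $\frac12\delta_{-\sqrt2}+\frac12\delta_{\sqrt2}$ as $M\to\infty$.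
   Context: For a finite positive measure $\mu$ on $\mathbb{R}$, $\operatorname{mass}(\mu)=\int1\,d\mu$ is its total mass; thus $\operatorname{mass}(\mu_{\alpha,M})=\#\{i:\lambda_i\ge0\}/M$ and $\operatorname{mass}(\mu_{\beta,M})=\#\{i:\lambda_i<0\}/M$. *)

theory Defs
  imports "HOL-Probability.Probability"
begin

definition mass :: "real measure \<Rightarrow> real" where
  "mass \<mu> = (\<integral>x. 1 \<partial>\<mu>)"

text \<open>The finite sum \<open>\<Sum>i\<in>I. c \<delta>\<^bsub>x i\<^esub>\<close> of equally weighted Dirac measures on the line,
  obtained by pushing forward along \<open>x\<close> the measure on the index set \<open>I\<close> that gives weight \<open>c\<close>
  to each point (so atoms are counted with multiplicity).\<close>

definition dirac_sum :: "real \<Rightarrow> 'i set \<Rightarrow> ('i \<Rightarrow> real) \<Rightarrow> real measure" where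
  "dirac_sum c I x = distr (point_measure I (\<lambda>_. ennreal c)) borel x"

lemma emeasure_dirac_sum:
  assumes "finite I" and "A \<in> sets borel"
  shows "emeasure (dirac_sum c I x) A = (\<Sum>i\<in>I. ennreal c * emeasure (return borel (x i)) A)"
proof -
  have "emeasure (dirac_sum c I x) A
      = emeasure (point_measure I (\<lambda>_. ennreal c)) (x -` A \<inter> I)"
    using assms by (simp add: dirac_sum_def emeasure_distr space_point_measure)
  also have "\<dots> = (\<Sum>i\<in>x -` A \<inter> I. ennreal c)"
    using assms by (subst emeasure_point_measure_finite) auto
  also have "\<dots> = (\<Sum>i\<in>I. ennreal c * emeasure (return borel (x i)) A)"
    using assms by (intro sum.mono_neutral_cong_left) (auto simp: indicator_def)
  finally show ?thesis .
qed

lemma mass_dirac_sum: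
  assumes "finite I" and "c \<ge> 0"
  shows "mass (dirac_sum c I x) = c * real (card I)"
proof -
  have "emeasure (dirac_sum c I x) UNIV = ennreal (c * real (card I))"
    using assms by (simp add: emeasure_dirac_sum ennreal_mult ennreal_of_nat_eq_real_of_nat mult.commute)
  moreover have "space (dirac_sum c I x) = UNIV"
    by (simp add: dirac_sum_def)
  ultimately show ?thesis
    using assms by (simp add: mass_def measure_def)
qed

definition ensemble_weight :: "nat \<Rightarrow> nat \<Rightarrow> (nat \<Rightarrow> real) \<Rightarrow> real" where
  "ensemble_weight N M x =
     (\<Prod>i=1..M. x i ^ (2 * (N - M))) *
     (\<Prod>(i, j)\<in>{(i, j). 1 \<le> i \<and> i < j \<and> j \<le> M}. \<bar>x i - x j\<bar> ^ 2) *
     (\<Prod>i=1..M. exp (- (real N * x i ^ 2 / 2)))"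

text \<open>The real random variables \<open>X i\<close>, \<open>i \<in> I\<close>, have a joint density with respect to Lebesgue measure
  on \<open>\<real>\<^sup>I\<close> that is a constant multiple of \<open>w\<close>. The restriction to \<open>I\<close> turns the tuple into an element
  of the (extensional) product space.\<close>

definition joint_density_proportional ::
    "'a measure \<Rightarrow> nat set \<Rightarrow> (nat \<Rightarrow> 'a \<Rightarrow> real) \<Rightarrow> ((nat \<Rightarrow> real) \<Rightarrow> real) \<Rightarrow> bool" where
  "joint_density_proportional P I X w \<longleftrightarrow>
     (\<exists>c>0. distributed P (Pi\<^sub>M I (\<lambda>_. lborel)) (\<lambda>\<omega>. \<lambda>i\<in>I. X i \<omega>) (\<lambda>x. ennreal (c * w x)))"

definition empirical_measure :: "nat \<Rightarrow> (nat \<Rightarrow> real) \<Rightarrow> real measure" where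
  "empirical_measure M l = dirac_sum (1 / real M) {1..M} l"

definition mu_alpha :: "nat \<Rightarrow> real \<Rightarrow> (nat \<Rightarrow> real) \<Rightarrow> real measure" where
  "mu_alpha M \<theta> l =
     dirac_sum (1 / real M) {i \<in> {1..M}. l i \<ge> 0} (\<lambda>i. inverse \<theta> * (l i - sqrt 2))"

definition mu_beta :: "nat \<Rightarrow> real \<Rightarrow> (nat \<Rightarrow> real) \<Rightarrow> real measure" where
  "mu_beta M \<theta> l =
     dirac_sum (1 / real M) {i \<in> {1..M}. l i < 0} (\<lambda>i. - (inverse \<theta> * (l i + sqrt 2)))"

end

theory Submission
  imports Defs "HOL-Real_Asymp.Real_Asymp"
begin

text \<open>
  Write \<open>s = sqrt (M / N)\<close>, which is small. The one-particle factor of the density is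
  \<open>(x\<^sup>2)\<^bsup>N\<^esup> exp (- N x\<^sup>2 / 2)\<close> up to a correction of exponential order \<open>M\<close>. It peaks at the two
  wells \<open>x = \<plusminus>sqrt 2\<close>, with peak value \<open>(2 / e)\<^bsup>N\<^esup>\<close>, and decays there like a Gaussian
  of width of order \<open>1 / sqrt N\<close>. The Vandermonde repulsion of up to \<open>M\<close> particles widens each
  cluster to the scale \<open>s\<close>. A configuration with \<open>k\<close> particles near \<open>sqrt 2\<close> and \<open>M - k\<close> near
  \<open>- sqrt 2\<close> therefore has total weight
  \<open>(2 / e)\<^bsup>N M\<^esup> s\<^bsup>k\<^sup>2 + (M - k)\<^sup>2\<^esup>\<close> up to factors \<open>exp (O(M\<^sup>2))\<close>: each pair inside one cluster
  contributes \<open>s\<^sup>2\<close>, each particle contributes \<open>s\<close> through its volume, and pairs in different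
  clusters contribute constants. Since \<open>k\<^sup>2 + (M - k)\<^sup>2 = M\<^sup>2 / 2 + 2 (k - M / 2)\<^sup>2\<close>, an imbalance
  \<open>\<bar>k - M / 2\<bar> \<ge> \<epsilon> M\<close> costs a factor \<open>s\<^bsup>2 \<epsilon>\<^sup>2 M\<^sup>2\<^esup>\<close>, which beats every \<open>exp (O(M\<^sup>2))\<close> because
  \<open>s\<close> tends to 0. Moving \<open>\<epsilon> M\<close> particles to distance \<open>\<delta>\<close> from both wells costs
  \<open>exp (- c \<epsilon> \<delta>\<^sup>2 N M)\<close>, and this beats both \<open>exp (O(M\<^sup>2))\<close> and the largest possible gain
  \<open>s\<^bsup>- O(M\<^sup>2)\<^esup>\<close>, because \<open>(M / N) log (N / M)\<close> tends to 0.

  These heuristics become proofs through two bounds on the unnormalised density. The lemma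
  \<open>ensemble_weight_upper\<close> dominates it everywhere by a product of one-particle functions. The lemma
  \<open>ensemble_weight_lower\<close> bounds it from below on a box of balanced configurations, and so bounds the
  normalising constant. Their quotient is \<open>ensemble_probability_le\<close>. Both rare events then have
  probability at most \<open>1 / N\<^sup>2\<close> for all large \<open>N\<close>, however slowly \<open>M\<close> grows, so the first
  Borel--Cantelli lemma gives almost sure statements for any coupling of the ensembles. The masses
  are the fractions of nonnegative and of negative coordinates. Weak convergence follows because a
  distribution function at a point other than the wells is determined by these fractions up to the
  fraction of particles far from the wells.
\<close>

section \<open>Products over pairs of indices\<close>

abbreviation index_pairs :: "nat \<Rightarrow> (nat \<times> nat) set" where
  "index_pairs M \<equiv> {(i, j). 1 \<le> i \<and> i < j \<and> j \<le> M}"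

lemma finite_index_pairs: "finite (index_pairs M)"
  by (rule finite_subset[of _ "{1..M} \<times> {1..M}"]) auto

lemma index_pairs_0: "index_pairs 0 = {}"
  by auto

lemma prod_index_pairs_Suc:
  fixes g :: "nat \<times> nat \<Rightarrow> 'a::comm_monoid_mult"
  shows "prod g (index_pairs (Suc M)) = prod g (index_pairs M) * (\<Prod>i=1..M. g (i, Suc M))"
proof -
  have eq: "index_pairs (Suc M) = index_pairs M \<union> (\<lambda>i. (i, Suc M)) ` {1..M}"
    by auto
  have "prod g ((\<lambda>i. (i, Suc M)) ` {1..M}) = (\<Prod>i=1..M. g (i, Suc M))"
    by (subst prod.reindex) (auto simp: inj_on_def)
  then show ?thesis
    unfolding eq using finite_index_pairs[of M] by (subst prod.union_disjoint) auto
qed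

text \<open>For a symmetric array, the square of the product over pairs runs over all off-diagonal entries.
  Supplying the diagonal turns a product over pairs into iterated products over the full index set,
  which factorise.\<close>

lemma prod_index_pairs_square:
  fixes f :: "nat \<Rightarrow> nat \<Rightarrow> 'a::comm_monoid_mult"
  assumes sym: "\<And>i j. f i j = f j i"
  shows "(\<Prod>(i, j)\<in>index_pairs M. f i j ^ 2) * (\<Prod>i=1..M. f i i)
       = (\<Prod>i=1..M. \<Prod>j=1..M. f i j)"
proof (induction M)
  case 0
  show ?case unfolding index_pairs_0 by simp
next
  case (Suc M)
  let ?P = "\<Prod>(i, j)\<in>index_pairs M. f i j ^ 2" and ?D = "\<Prod>i=1..M. f i i"
  let ?R = "\<Prod>i=1..M. f i (Suc M)"
  have "(\<Prod>i=1..Suc M. \<Prod>j=1..Suc M. f i j)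
      = (\<Prod>i=1..M. \<Prod>j=1..M. f i j) * ?R * ((\<Prod>j=1..M. f (Suc M) j) * f (Suc M) (Suc M))"
    by (simp add: prod.distrib ac_simps)
  also have "(\<Prod>j=1..M. f (Suc M) j) = ?R"
    by (intro prod.cong refl sym)
  also have "(\<Prod>i=1..M. \<Prod>j=1..M. f i j) = ?P * ?D"
    using Suc.IH by simp
  finally have R: "(\<Prod>i=1..Suc M. \<Prod>j=1..Suc M. f i j)
      = ?P * ?D * ?R * (?R * f (Suc M) (Suc M))" .
  have L: "(\<Prod>(i, j)\<in>index_pairs (Suc M). f i j ^ 2) = ?P * ?R ^ 2"
    by (subst prod_index_pairs_Suc) (simp add: power2_eq_square prod.distrib)
  show ?case
    unfolding R L by (simp add: power2_eq_square ac_simps)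
qed

text \<open>This is the count of pairs that share a block when \<open>{1..M}\<close> is split into \<open>S\<close> and its complement,
  in multiplicative form: the \<open>M\<close> diagonal factors complete the two blocks to squares of side
  \<open>card S\<close> and \<open>M - card S\<close>.\<close>

lemma prod_same_block:
  fixes s :: "'a::comm_monoid_mult"
  assumes "S \<subseteq> {1..M}"
  shows "(\<Prod>(i, j)\<in>index_pairs M. (if i \<in> S \<longleftrightarrow> j \<in> S then s else 1) ^ 2) * s ^ M
       = s ^ ((card S)\<^sup>2 + (M - card S)\<^sup>2)"
proof -
  have fin: "finite S" using assms finite_subset by blast
  let ?f = "\<lambda>i j. if i \<in> S \<longleftrightarrow> j \<in> S then s else 1"
  let ?T = "{1..M} - S"
  have cT: "card ?T = M - card S" using assms fin by (simp add: card_Diff_subset)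
  have row: "(\<Prod>j=1..M. ?f i j) = (if i \<in> S then s ^ card S else s ^ card ?T)" for i
  proof -
    have "(\<Prod>j=1..M. ?f i j) = (\<Prod>j\<in>(if i \<in> S then S else ?T). s)"
      using assms by (intro prod.mono_neutral_cong_right) auto
    then show ?thesis by simp
  qed
  have "(\<Prod>i=1..M. \<Prod>j=1..M. ?f i j)
      = (\<Prod>i=1..M. if i \<in> S then s ^ card S else s ^ card ?T)"
    by (intro prod.cong refl row)
  also have "\<dots> = (\<Prod>i\<in>S \<union> ?T. if i \<in> S then s ^ card S else s ^ card ?T)"
    using assms by (intro prod.cong) auto
  also have "\<dots> = (s ^ card S) ^ card S * (s ^ card ?T) ^ card ?T"
    using fin by (subst prod.union_disjoint) auto
  also have "\<dots> = s ^ ((card S)\<^sup>2 + (M - card S)\<^sup>2)"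
    unfolding cT by (simp add: power2_eq_square power_add power_mult)
  finally have "(\<Prod>i=1..M. \<Prod>j=1..M. ?f i j) = s ^ ((card S)\<^sup>2 + (M - card S)\<^sup>2)" .
  moreover have "(\<Prod>(i, j)\<in>index_pairs M. ?f i j ^ 2) * (\<Prod>i=1..M. ?f i i)
      = (\<Prod>i=1..M. \<Prod>j=1..M. ?f i j)"
    by (rule prod_index_pairs_square) auto
  moreover have "(\<Prod>i=1..M. ?f i i) = s ^ M" by simp
  ultimately show ?thesis by (simp only:)
qed

text \<open>The pairs with larger index \<open>j\<close> contribute \<open>(j - 1)! / K\<^bsup>j - 1\<^esup>\<close>, and \<open>K\<^sup>n / n!\<close> is one term of
  the series of \<open>exp K\<close>. With \<open>K\<close> proportional to \<open>M\<close> the loss is only exponential in \<open>M\<^sup>2\<close>, which a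
  factor-by-factor bound such as \<open>K\<^bsup>- M\<^sup>2\<^esup>\<close> would not give.\<close>

lemma prod_index_pairs_gap_lower:
  assumes "K > 0"
  shows "(\<Prod>(i, j)\<in>index_pairs M. (real j - real i) / K) \<ge> exp (- (K * real M))"
proof (induction M)
  case 0
  show ?case unfolding index_pairs_0 by simp
next
  case (Suc M)
  have bij: "(\<Prod>i=1..M. real (Suc M) - real i) = fact M"
  proof -
    have "(\<Prod>i=1..M. real (Suc M) - real i) = (\<Prod>i=1..M. real i)"
      by (rule prod.reindex_bij_witness[of _ "\<lambda>i. Suc M - i" "\<lambda>i. Suc M - i"]) auto
    then show ?thesis by (simp add: fact_prod)
  qed
  have "K ^ M / fact M \<le> exp K"
  proof -
    have "(\<Sum>k\<in>{M}. inverse (fact k) * K ^ k) \<le> (\<Sum>k. inverse (fact k) * K ^ k)"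
      using assms by (intro sum_le_suminf summable_exp) auto
    then show ?thesis by (simp add: exp_def field_simps)
  qed
  then have "exp (- K) \<le> fact M / K ^ M"
    using assms by (simp add: exp_minus field_simps)
  also have "\<dots> = (\<Prod>i=1..M. (real (Suc M) - real i) / K)"
    unfolding prod_dividef bij by simp
  finally have "exp (- (K * real M)) * exp (- K)
      \<le> (\<Prod>(i, j)\<in>index_pairs M. (real j - real i) / K) * (\<Prod>i=1..M. (real (Suc M) - real i) / K)"
    using Suc.IH by (intro mult_mono) (auto intro!: prod_nonneg simp: assms less_imp_le)
  then show ?case
    by (subst prod_index_pairs_Suc) (simp add: exp_add[symmetric] algebra_simps)
qed

section \<open>The one-particle weight\<close>

text \<open>The wells are \<open>sqrt 2\<close> and \<open>- sqrt 2\<close>. Offsets are signed, positive on the outer side, and treat both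
  wells alike, so that for points of equal sign \<open>\<bar>x - y\<bar>\<close> is the difference of the offsets.\<close>

abbreviation well_offset :: "real \<Rightarrow> real" where
  "well_offset x \<equiv> \<bar>x\<bar> - sqrt 2"

abbreviation site_weight :: "nat \<Rightarrow> nat \<Rightarrow> real \<Rightarrow> real" where
  "site_weight N M x \<equiv> x ^ (2 * (N - M)) * exp (- (real N * x ^ 2 / 2))"

lemma site_weight_nonneg: "site_weight N M x \<ge> 0"
  by (simp add: power_mult)

text \<open>The function \<open>x\<^sup>2 exp (- x\<^sup>2 / 2)\<close>, whose powers drive the one-particle weight, normalised to have
  maximum 1, attained at the wells.\<close>
definition well_profile :: "real \<Rightarrow> real" where
  "well_profile x = x\<^sup>2 / 2 * exp (1 - x\<^sup>2 / 2)"

lemma well_profile_nonneg: "well_profile x \<ge> 0"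
  by (simp add: well_profile_def)

text \<open>Splitting the Gaussian into \<open>N - M\<close> and \<open>M\<close> factors keeps all exponents nonnegative, so that no
  separate treatment of \<open>x = 0\<close> is needed.\<close>

lemma site_weight_eq_well_profile:
  assumes "M \<le> N"
  shows "site_weight N M x
       = (2 / exp 1) ^ N * well_profile x ^ (N - M) * (exp 1 / 2 * exp (- (x\<^sup>2 / 2))) ^ M"
proof -
  obtain d where N: "N = M + d" using assms le_Suc_ex by blast
  have e: "exp (1 - x\<^sup>2 / 2) = exp 1 * exp (- (x\<^sup>2 / 2))"
    by (simp flip: exp_add)
  have "exp (- (real N * x\<^sup>2 / 2)) = exp (- (x\<^sup>2 / 2)) ^ N"
    by (simp add: exp_of_nat_mult[symmetric])
  moreover have "x ^ (2 * (N - M)) = (x\<^sup>2) ^ (N - M)"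
    by (rule power_mult)
  ultimately show ?thesis
    unfolding well_profile_def e N by (simp add: power_add power_mult_distrib power_divide)
qed

text \<open>With \<open>y = \<bar>x\<bar> / sqrt 2\<close>, the inequality \<open>y \<le> exp (y - 1)\<close>, squared, replaces \<open>x\<^sup>2 / 2\<close> by the exponential
  of a linear function; the remaining quadratic is the square of the offset.\<close>

lemma well_profile_upper: "well_profile x \<le> exp (- ((well_offset x)\<^sup>2 / 2))"
proof -
  let ?y = "\<bar>x\<bar> / sqrt 2"
  have "?y \<le> exp (?y - 1)"
    using exp_ge_add_one_self[of "?y - 1"] by simp
  then have "?y\<^sup>2 \<le> (exp (?y - 1))\<^sup>2"
    by (intro power_mono) auto
  also have "\<dots> = exp (2 * ?y - 2)"
    by (simp add: exp_of_nat_mult[symmetric] algebra_simps)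
  finally have "x\<^sup>2 / 2 \<le> exp (2 * ?y - 2)"
    by (simp add: power_divide)
  then have "well_profile x \<le> exp (2 * ?y - 2) * exp (1 - x\<^sup>2 / 2)"
    unfolding well_profile_def by (intro mult_right_mono) auto
  also have "\<dots> = exp (2 * ?y - 1 - x\<^sup>2 / 2)"
    by (simp add: exp_add[symmetric])
  also have "2 * ?y = sqrt 2 * \<bar>x\<bar>"
    by (simp add: field_simps)
  also have "sqrt 2 * \<bar>x\<bar> - 1 - x\<^sup>2 / 2 = - ((well_offset x)\<^sup>2 / 2)"
    by (simp add: power2_eq_square field_simps)
  finally show ?thesis .
qed

text \<open>With \<open>v\<close> the offset divided by \<open>sqrt 2\<close>, the profile is \<open>(1 + v)\<^sup>2 exp (1 - (1 + v)\<^sup>2)\<close>. In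
  \<open>1 + v \<ge> exp (v - v\<^sup>2)\<close> the linear term cancels against that of the Gaussian.\<close>

lemma well_profile_lower:
  assumes "sqrt 2 \<le> \<bar>x\<bar>" "\<bar>x\<bar> \<le> sqrt 2 + 1"
  shows "well_profile x \<ge> exp (- (3 / 2 * (well_offset x)\<^sup>2))"
proof -
  define v where "v = well_offset x / sqrt 2"
  have s2: "sqrt 2 \<ge> 1" by simp
  have "\<bar>x\<bar> \<le> 2 * sqrt 2" using assms s2 by linarith
  then have v: "0 \<le> v" "v \<le> 1" using assms by (auto simp: v_def divide_le_eq)
  have x: "\<bar>x\<bar> = sqrt 2 * (1 + v)" by (simp add: v_def field_simps)
  have x2: "x\<^sup>2 = 2 * (1 + v)\<^sup>2"
    using arg_cong[OF x, of "\<lambda>y. y\<^sup>2"] by (simp add: power_mult_distrib)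
  have v2: "(well_offset x)\<^sup>2 = 2 * v\<^sup>2" by (simp add: v_def power_divide)
  have "exp (v - v\<^sup>2) \<le> 1 + v"
    using ln_one_plus_pos_lower_bound[OF v] v by (subst ln_ge_iff[symmetric]) auto
  then have "(exp (v - v\<^sup>2))\<^sup>2 \<le> (1 + v)\<^sup>2"
    by (intro power_mono) auto
  then have "exp (2 * (v - v\<^sup>2)) * exp (1 - (1 + v)\<^sup>2) \<le> (1 + v)\<^sup>2 * exp (1 - (1 + v)\<^sup>2)"
    by (intro mult_right_mono) (auto simp: exp_of_nat_mult[symmetric])
  also have "exp (2 * (v - v\<^sup>2)) * exp (1 - (1 + v)\<^sup>2) = exp (- (3 / 2 * (well_offset x)\<^sup>2))"
    unfolding v2 exp_add[symmetric] by (simp add: power2_eq_square algebra_simps)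
  finally show ?thesis
    unfolding well_profile_def x2 by simp
qed

text \<open>The polynomial factor is what a particle contributes to the Vandermonde product in the upper bound for
  the joint density, one factor per partner and squared. It is absorbed as follows. The profile yields at offset \<open>u\<close> a decay
  with exponent \<open>3 N u\<^sup>2 / 8\<close>, which is spent in three equal shares: on the growth of
  \<open>(1 + \<bar>u\<bar> / s)\<^bsup>2 M\<^esup>\<close>, where \<open>M (u / s)\<^sup>2 = N u\<^sup>2\<close>; on the cost of leaving the wells; and on an
  integrable Gaussian. The spare factor \<open>exp (- M x\<^sup>2 / 2)\<close> absorbs \<open>(1 + \<bar>x\<bar>)\<^bsup>2 M\<^esup>\<close>. The constant 96
  is the product of the losses 16 and 6 in these two absorptions.\<close>

lemma site_weight_upper:
  assumes M: "1 \<le> M" "4 * M \<le> N" and s: "s > 0" "real N * s\<^sup>2 = real M"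
  shows "site_weight N M x * ((1 + \<bar>well_offset x\<bar> / s) * (1 + \<bar>x\<bar>)) ^ (2 * M)
       \<le> (2 / exp 1) ^ N * 96 ^ M * exp (- (real N * (well_offset x)\<^sup>2 / 8))
           * exp (- ((well_offset x)\<^sup>2 / 8))"
proof -
  define u where "u = well_offset x"
  define t where "t = \<bar>u\<bar> / s"
  have t: "t \<ge> 0" using s by (simp add: t_def)
  have ut: "real N * u\<^sup>2 = real M * t\<^sup>2"
    using s by (simp add: t_def power_divide field_simps flip: s(2))
  have "(1 + t)\<^sup>2 \<le> 16 * (1 + t\<^sup>2 / 8)"
    using zero_le_power2[of "t - 1"] by (simp add: power2_eq_square algebra_simps)
  also have "\<dots> \<le> 16 * exp (t\<^sup>2 / 8)"
    by (intro mult_left_mono exp_ge_add_one_self) auto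
  finally have "((1 + t)\<^sup>2) ^ M \<le> (16 * exp (t\<^sup>2 / 8)) ^ M"
    by (intro power_mono) auto
  also have "\<dots> = 16 ^ M * exp (real N * u\<^sup>2 / 8)"
    unfolding ut by (simp add: power_mult_distrib exp_of_nat_mult[symmetric])
  finally have 1: "((1 + t)\<^sup>2) ^ M \<le> 16 ^ M * exp (real N * u\<^sup>2 / 8)" .
  have "(1 + \<bar>x\<bar>)\<^sup>2 \<le> 4 * (1 + x\<^sup>2 / 2)"
    using zero_le_power2[of "\<bar>x\<bar> - 1"] by (simp add: power2_eq_square algebra_simps)
  also have "\<dots> \<le> 4 * exp (x\<^sup>2 / 2)"
    by (intro mult_left_mono exp_ge_add_one_self) auto
  finally have "exp 1 / 2 * exp (- (x\<^sup>2 / 2)) * (1 + \<bar>x\<bar>)\<^sup>2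
      \<le> 3 / 2 * exp (- (x\<^sup>2 / 2)) * (4 * exp (x\<^sup>2 / 2))"
    using exp_le by (intro mult_mono) auto
  also have "\<dots> = 6" by (simp add: exp_minus)
  finally have 2: "(exp 1 / 2 * exp (- (x\<^sup>2 / 2)) * (1 + \<bar>x\<bar>)\<^sup>2) ^ M \<le> 6 ^ M"
    by (intro power_mono) auto
  have "well_profile x ^ (N - M) \<le> exp (- (u\<^sup>2 / 2)) ^ (N - M)"
    unfolding u_def by (intro power_mono well_profile_upper well_profile_nonneg)
  also have "\<dots> = exp (- (real (N - M) * u\<^sup>2 / 2))"
    by (simp add: exp_of_nat_mult[symmetric])
  also have "\<dots> \<le> exp (- (real N * u\<^sup>2 * (3 / 8)))"
  proof -
    have "(3 / 4 * real N) * u\<^sup>2 \<le> real (N - M) * u\<^sup>2"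
      using M by (intro mult_right_mono) (auto simp: of_nat_diff)
    then show ?thesis by simp
  qed
  finally have 3: "well_profile x ^ (N - M) \<le> exp (- (real N * u\<^sup>2 * (3 / 8)))" .
  have "site_weight N M x * ((1 + t) * (1 + \<bar>x\<bar>)) ^ (2 * M)
      = (2 / exp 1) ^ N * (well_profile x ^ (N - M)
          * ((exp 1 / 2 * exp (- (x\<^sup>2 / 2)) * (1 + \<bar>x\<bar>)\<^sup>2) ^ M * ((1 + t)\<^sup>2) ^ M))"
  proof -
    have regroup: "(A * W * E ^ M) * (a * b) ^ (2 * M) = A * (W * ((E * b\<^sup>2) ^ M * (a\<^sup>2) ^ M))"
      for A W E a b :: real
      by (simp add: power_mult_distrib power_mult)
    show ?thesis
      using M by (subst site_weight_eq_well_profile) (simp_all only: regroup)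
  qed
  also have "\<dots> \<le> (2 / exp 1) ^ N * (exp (- (real N * u\<^sup>2 * (3 / 8)))
          * (6 ^ M * (16 ^ M * exp (real N * u\<^sup>2 / 8))))"
    using 1 2 3 by (intro mult_left_mono mult_mono) (auto simp: well_profile_nonneg)
  also have "\<dots> = (2 / exp 1) ^ N * 96 ^ M * exp (- (real N * u\<^sup>2 / 8) - real N * u\<^sup>2 / 8)"
  proof -
    have "(96::real) ^ M = 6 ^ M * 16 ^ M" by (simp flip: power_mult_distrib)
    moreover have "exp (- (real N * u\<^sup>2 / 8) - real N * u\<^sup>2 / 8)
        = exp (- (real N * u\<^sup>2 * (3 / 8))) * exp (real N * u\<^sup>2 / 8)"
      by (simp flip: exp_add)
    ultimately show ?thesis by simp
  qed
  also have "\<dots> \<le> (2 / exp 1) ^ N * 96 ^ M * exp (- (real N * u\<^sup>2 / 8) - u\<^sup>2 / 8)"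
  proof -
    have "1 * u\<^sup>2 \<le> real N * u\<^sup>2" using M by (intro mult_right_mono) auto
    then show ?thesis by (intro mult_left_mono) auto
  qed
  also have "exp (- (real N * u\<^sup>2 / 8) - u\<^sup>2 / 8) = exp (- (real N * u\<^sup>2 / 8)) * exp (- (u\<^sup>2 / 8))"
    by (simp flip: exp_add)
  finally show ?thesis
    unfolding t_def u_def by (simp only: mult.assoc)
qed

text \<open>Within distance of order \<open>s = sqrt (M / N)\<close> of a well, \<open>N u\<^sup>2\<close> is at most of order \<open>M\<close>, so only a factor
  exponential in \<open>M\<close> is lost against the peak value.\<close>

lemma site_weight_lower:
  assumes M: "M \<le> N" and s: "0 < s" "s \<le> 1 / 2" "real N * s\<^sup>2 = real M"
    and x: "sqrt 2 \<le> \<bar>x\<bar>" "\<bar>x\<bar> \<le> sqrt 2 + 2 * s"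
  shows "site_weight N M x \<ge> (2 / exp 1) ^ N * exp (- (10 * real M))"
proof -
  define u where "u = well_offset x"
  have u: "0 \<le> u" "u \<le> 2 * s" using x by (auto simp: u_def)
  have u2: "u\<^sup>2 \<le> 4 * s\<^sup>2" using power_mono[OF u(2) u(1), of 2] by (simp add: power_mult_distrib)
  have "exp (- (6 * real M)) \<le> exp (- (real (N - M) * (3 / 2 * u\<^sup>2)))"
  proof -
    have "real (N - M) * (3 / 2 * u\<^sup>2) \<le> real N * (3 / 2 * (4 * s\<^sup>2))"
      using u2 by (intro mult_mono) auto
    then show ?thesis using s(3) by simp
  qed
  also have "\<dots> = exp (- (3 / 2 * u\<^sup>2)) ^ (N - M)"
    by (simp add: exp_of_nat_mult[symmetric])
  also have "\<dots> \<le> well_profile x ^ (N - M)"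
    unfolding u_def using x s by (intro power_mono well_profile_lower) auto
  finally have 1: "exp (- (6 * real M)) \<le> well_profile x ^ (N - M)" .
  have sq: "sqrt 2 \<le> 3 / 2" by (rule real_le_lsqrt) (auto simp: power2_eq_square)
  have "x\<^sup>2 \<le> (5 / 2)\<^sup>2"
    using x s sq by (intro power2_le_iff_abs_le[THEN iffD2]) auto
  then have "exp (- 4) \<le> 1 * exp (- (x\<^sup>2 / 2))"
    by (simp add: power2_eq_square)
  also have "\<dots> \<le> exp 1 / 2 * exp (- (x\<^sup>2 / 2))"
    using exp_ge_add_one_self[of 1] by (intro mult_right_mono) auto
  finally have "exp (- 4) ^ M \<le> (exp 1 / 2 * exp (- (x\<^sup>2 / 2))) ^ M"
    by (intro power_mono) auto
  then have 2: "exp (- (4 * real M)) \<le> (exp 1 / 2 * exp (- (x\<^sup>2 / 2))) ^ M"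
    by (simp add: exp_of_nat_mult[symmetric] mult.commute)
  have "(2 / exp 1) ^ N * exp (- (10 * real M))
      = (2 / exp 1) ^ N * (exp (- (6 * real M)) * exp (- (4 * real M)))"
    by (simp flip: exp_add)
  also have "\<dots> \<le> (2 / exp 1) ^ N *
      (well_profile x ^ (N - M) * (exp 1 / 2 * exp (- (x\<^sup>2 / 2))) ^ M)"
    using 1 2 by (intro mult_left_mono mult_mono) (auto simp: well_profile_nonneg)
  finally show ?thesis
    using M by (subst site_weight_eq_well_profile) (auto simp: mult.assoc)
qed

section \<open>Pointwise bounds for the joint density\<close>

lemma ensemble_weight_eq:
  "ensemble_weight N M x
     = (\<Prod>i=1..M. site_weight N M (x i)) * (\<Prod>(i, j)\<in>index_pairs M. \<bar>x i - x j\<bar> ^ 2)"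
  unfolding ensemble_weight_def by (simp add: prod.distrib mult_ac)

lemma distance_upper_same_side:
  assumes "s > 0" "x \<ge> 0 \<longleftrightarrow> y \<ge> 0"
  shows "\<bar>x - y\<bar> \<le> s * ((1 + \<bar>well_offset x\<bar> / s) * (1 + \<bar>well_offset y\<bar> / s))"
proof -
  have "\<bar>x - y\<bar> = \<bar>well_offset x - well_offset y\<bar>"
    using assms by auto
  also have "\<dots> \<le> \<bar>well_offset x\<bar> + \<bar>well_offset y\<bar>" by linarith
  also have "\<dots> = s * (\<bar>well_offset x\<bar> / s + \<bar>well_offset y\<bar> / s)"
    using assms by (simp add: field_simps)
  also have "\<dots> \<le> s * ((1 + \<bar>well_offset x\<bar> / s) * (1 + \<bar>well_offset y\<bar> / s))"
    using assms by (intro mult_left_mono) (auto simp: algebra_simps)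
  finally show ?thesis .
qed

text \<open>Each distance is at most \<open>s\<close> for particles on the same side of 0, and 1 otherwise, times one factor for
  each of the two particles: \<open>(1 + \<bar>u\<bar> / s) (1 + \<bar>x\<bar>)\<close> with \<open>u\<close> the offset. This decouples the Vandermonde
  product into the block count and the factors treated in the lemma \<open>site_weight_upper\<close>. The power
  \<open>s\<^sup>M\<close> on the left completes the block count to \<open>k\<^sup>2 + (M - k)\<^sup>2\<close>.\<close>

lemma ensemble_weight_upper:
  fixes x :: "nat \<Rightarrow> real"
  assumes M: "1 \<le> M" "4 * M \<le> N" and s: "s > 0" "real N * s\<^sup>2 = real M"
  defines "k \<equiv> card {i \<in> {1..M}. x i \<ge> 0}"
  shows "ensemble_weight N M x * s ^ M
       \<le> s ^ (k\<^sup>2 + (M - k)\<^sup>2) * ((2 / exp 1) ^ (N * M) * 96 ^ (M * M)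
           * exp (- (real N / 8 * (\<Sum>i=1..M. (well_offset (x i))\<^sup>2)))
           * (\<Prod>i=1..M. exp (- ((well_offset (x i))\<^sup>2 / 8))))"
proof -
  define a where "a i = (1 + \<bar>well_offset (x i)\<bar> / s) * (1 + \<bar>x i\<bar>)" for i
  define S where "S = {i \<in> {1..M}. x i \<ge> 0}"
  define f where "f i j = (if i \<in> S \<longleftrightarrow> j \<in> S then s else 1)" for i j
  have t1: "1 \<le> 1 + \<bar>well_offset (x i)\<bar> / s" for i using s by simp
  have a1: "1 \<le> a i" for i
    unfolding a_def using mult_mono[OF t1[of i], of 1 "1 + \<bar>x i\<bar>"] s by auto
  have a0: "0 \<le> a i" for i using a1[of i] by linarith
  have aa: "1 \<le> a i * a i" for i using mult_mono[OF a1[of i] a1[of i] a0] by simp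
  have f0: "0 \<le> f i j" for i j using s by (simp add: f_def)
  have dist: "\<bar>x i - x j\<bar> \<le> f i j * (a i * a j)" if "i \<in> {1..M}" "j \<in> {1..M}" for i j
  proof -
    let ?p = "(1 + \<bar>well_offset (x i)\<bar> / s) * (1 + \<bar>well_offset (x j)\<bar> / s)"
    let ?q = "(1 + \<bar>x i\<bar>) * (1 + \<bar>x j\<bar>)"
    have p: "1 \<le> ?p" using mult_mono[OF t1[of i] t1[of j]] s by auto
    have q: "1 \<le> ?q" using mult_mono[of 1 "1 + \<bar>x i\<bar>" 1 "1 + \<bar>x j\<bar>"] by auto
    have pq: "a i * a j = ?p * ?q" by (simp add: a_def)
    show ?thesis
    proof (cases "i \<in> S \<longleftrightarrow> j \<in> S")
      case True
      then have "\<bar>x i - x j\<bar> \<le> s * ?p"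
        using that by (intro distance_upper_same_side s) (auto simp: S_def)
      also have "\<dots> = s * ?p * 1" by simp
      also have "\<dots> \<le> s * ?p * ?q" using p q s by (intro mult_left_mono) auto
      finally show ?thesis using True by (simp add: f_def pq mult.assoc)
    next
      case False
      have "\<bar>x i - x j\<bar> \<le> ?q"
        using abs_triangle_ineq4[of "x i" "x j"] mult_nonneg_nonneg[of "\<bar>x i\<bar>" "\<bar>x j\<bar>"]
        by (simp only: distrib_left distrib_right) linarith
      also have "\<dots> = 1 * ?q" by simp
      also have "\<dots> \<le> ?p * ?q" using p q by (intro mult_right_mono) linarith+
      finally show ?thesis using False by (simp add: f_def pq)
    qed
  qed
  have "(\<Prod>(i, j)\<in>index_pairs M. \<bar>x i - x j\<bar> ^ 2)
      \<le> (\<Prod>(i, j)\<in>index_pairs M. (f i j * (a i * a j)) ^ 2)"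
    using dist by (intro prod_mono, clarify, intro conjI power_mono) auto
  also have "\<dots> = (\<Prod>(i, j)\<in>index_pairs M. f i j ^ 2) * (\<Prod>(i, j)\<in>index_pairs M. (a i * a j) ^ 2)"
    by (simp add: prod.distrib[symmetric] power_mult_distrib case_prod_unfold)
  also have "\<dots> \<le> (\<Prod>(i, j)\<in>index_pairs M. f i j ^ 2) * (\<Prod>i=1..M. a i ^ (2 * M))"
  proof (intro mult_left_mono)
    \<comment> \<open>The diagonal factors are at least 1, so completing the product only enlarges it.\<close>
    have "(\<Prod>(i, j)\<in>index_pairs M. (a i * a j) ^ 2) * 1
        \<le> (\<Prod>(i, j)\<in>index_pairs M. (a i * a j) ^ 2) * (\<Prod>i=1..M. a i * a i)"
      by (intro mult_left_mono prod_ge_1 prod_nonneg aa) auto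
    also have "\<dots> = (\<Prod>i=1..M. \<Prod>j=1..M. a i * a j)"
      by (intro prod_index_pairs_square) (simp add: mult.commute)
    also have "\<dots> = (\<Prod>i=1..M. a i ^ M) * (\<Prod>j=1..M. a j) ^ M"
      by (simp add: prod.distrib)
    also have "\<dots> = (\<Prod>i=1..M. a i ^ (2 * M))"
      by (simp add: prod.distrib[symmetric] prod_power_distrib power_add[symmetric] mult_2)
    finally show "(\<Prod>(i, j)\<in>index_pairs M. (a i * a j) ^ 2) \<le> (\<Prod>i=1..M. a i ^ (2 * M))"
      by simp
  qed (auto intro!: prod_nonneg)
  finally have "ensemble_weight N M x \<le> (\<Prod>i=1..M. site_weight N M (x i))
      * ((\<Prod>(i, j)\<in>index_pairs M. f i j ^ 2) * (\<Prod>i=1..M. a i ^ (2 * M)))"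
    unfolding ensemble_weight_eq
    by (intro mult_left_mono prod_nonneg ballI site_weight_nonneg)
  also have "\<dots> = (\<Prod>(i, j)\<in>index_pairs M. f i j ^ 2)
      * (\<Prod>i=1..M. site_weight N M (x i) * a i ^ (2 * M))"
    by (simp add: prod.distrib mult_ac)
  also have "\<dots> \<le> (\<Prod>(i, j)\<in>index_pairs M. f i j ^ 2)
      * (\<Prod>i=1..M. (2 / exp 1) ^ N * 96 ^ M * exp (- (real N * (well_offset (x i))\<^sup>2 / 8))
           * exp (- ((well_offset (x i))\<^sup>2 / 8)))"
    unfolding a_def using site_weight_upper[OF M s]
    by (intro mult_left_mono prod_mono conjI mult_nonneg_nonneg site_weight_nonneg)
       (auto intro!: prod_nonneg simp: power_mult)
  finally have "ensemble_weight N M x * s ^ M \<le> (\<Prod>(i, j)\<in>index_pairs M. f i j ^ 2)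
      * (\<Prod>i=1..M. (2 / exp 1) ^ N * 96 ^ M * exp (- (real N * (well_offset (x i))\<^sup>2 / 8))
           * exp (- ((well_offset (x i))\<^sup>2 / 8))) * s ^ M"
    using s by (intro mult_right_mono) auto
  also have "\<dots> = ((\<Prod>(i, j)\<in>index_pairs M. f i j ^ 2) * s ^ M)
      * (\<Prod>i=1..M. (2 / exp 1) ^ N * 96 ^ M * exp (- (real N * (well_offset (x i))\<^sup>2 / 8))
           * exp (- ((well_offset (x i))\<^sup>2 / 8)))"
    by (simp add: mult_ac)
  also have "(\<Prod>(i, j)\<in>index_pairs M. f i j ^ 2) * s ^ M = s ^ (k\<^sup>2 + (M - k)\<^sup>2)"
    unfolding f_def k_def S_def[symmetric] by (rule prod_same_block) (auto simp: S_def)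
  also have "(\<Prod>i=1..M. (2 / exp 1) ^ N * 96 ^ M * exp (- (real N * (well_offset (x i))\<^sup>2 / 8))
           * exp (- ((well_offset (x i))\<^sup>2 / 8)))
      = (2 / exp 1) ^ (N * M) * 96 ^ (M * M)
           * exp (- (real N / 8 * (\<Sum>i=1..M. (well_offset (x i))\<^sup>2)))
           * (\<Prod>i=1..M. exp (- ((well_offset (x i))\<^sup>2 / 8)))"
  proof -
    have E: "(\<Prod>i=1..M. exp (- (real N * (well_offset (x i))\<^sup>2 / 8)))
        = exp (- (real N / 8 * (\<Sum>i=1..M. (well_offset (x i))\<^sup>2)))"
      by (simp add: exp_sum[symmetric] sum_negf sum_distrib_left)
    have split: "(\<Prod>i=1..M. A * B * e i * g i) = A ^ M * B ^ M * (\<Prod>i=1..M. e i) * (\<Prod>i=1..M. g i)"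
      for A B :: real and e g
      by (simp add: prod.distrib power_mult_distrib)
    show ?thesis by (simp only: split E power_mult)
  qed
  finally show ?thesis .
qed

text \<open>Cell of the \<open>i\<close>-th particle in a box of balanced configurations: the first \<open>M div 2\<close> particles lie
  just outside \<open>sqrt 2\<close>, the others just outside \<open>- sqrt 2\<close>, on a grid of mesh \<open>s / M\<close>. Each cell takes half
  of its mesh interval, so that particles with indices \<open>i < j\<close> on the same side stay at least
  \<open>s (j - i) / (2 M)\<close> apart.\<close>
definition reference_cell :: "nat \<Rightarrow> real \<Rightarrow> nat \<Rightarrow> real set" where
  "reference_cell M s i =
     (let c = sqrt 2 + s * real i / real M; d = s / (2 * real M)
      in if i \<le> M div 2 then {c..c + d} else {- c - d..- c})"

lemma reference_cell_abs:
  assumes "1 \<le> M" "s > 0" "x \<in> reference_cell M s i"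
  shows "\<bar>x\<bar> \<in> {sqrt 2 + s * real i / real M..sqrt 2 + s * real i / real M + s / (2 * real M)}"
    and "x \<ge> 0 \<longleftrightarrow> i \<le> M div 2"
proof -
  have "0 < sqrt 2 + s * real i / real M" using assms by (intro add_pos_nonneg) auto
  then show "\<bar>x\<bar> \<in> {sqrt 2 + s * real i / real M..sqrt 2 + s * real i / real M + s / (2 * real M)}"
    and "x \<ge> 0 \<longleftrightarrow> i \<le> M div 2"
    using assms(3) unfolding reference_cell_def Let_def by (auto split: if_splits)
qed

lemma reference_cell_distance:
  assumes M: "1 \<le> M" and s: "0 < s" "s \<le> 1 / 2" and ij: "i < j" "j \<le> M"
    and x: "x \<in> reference_cell M s i" and y: "y \<in> reference_cell M s j"
  shows "(if i \<le> M div 2 \<longleftrightarrow> j \<le> M div 2 then s else 1) * ((real j - real i) / (2 * real M))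
       \<le> \<bar>x - y\<bar>"
proof (cases "i \<le> M div 2 \<longleftrightarrow> j \<le> M div 2")
  case True
  then have "\<bar>x - y\<bar> = \<bar>\<bar>x\<bar> - \<bar>y\<bar>\<bar>"
    using reference_cell_abs(2)[OF M s(1) x] reference_cell_abs(2)[OF M s(1) y] by auto
  also have "\<dots> \<ge> s * real j / real M - (s * real i / real M + s / (2 * real M))"
    using reference_cell_abs(1)[OF M s(1) x] reference_cell_abs(1)[OF M s(1) y] by auto
  also have "s * real j / real M - (s * real i / real M + s / (2 * real M))
      = s * (2 * (real j - real i) - 1) / (2 * real M)"
    using M by (simp add: field_simps)
  finally have "s * (2 * (real j - real i) - 1) / (2 * real M) \<le> \<bar>x - y\<bar>" .
  moreover have "s * (real j - real i) / (2 * real M) \<le> s * (2 * (real j - real i) - 1) / (2 * real M)"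
    using s ij M by (intro divide_right_mono mult_left_mono) auto
  ultimately show ?thesis using True by simp
next
  case False
  then have "\<bar>x - y\<bar> = \<bar>x\<bar> + \<bar>y\<bar>"
    using reference_cell_abs(2)[OF M s(1) x] reference_cell_abs(2)[OF M s(1) y] by auto
  moreover have "0 \<le> s * real i / real M" "0 \<le> s * real j / real M" using s by auto
  then have "1 \<le> \<bar>x\<bar> + \<bar>y\<bar>"
    using reference_cell_abs(1)[OF M s(1) x] reference_cell_abs(1)[OF M s(1) y]
      real_le_rsqrt[of 1 2] by (auto simp del: real_sqrt_ge_1_iff)
  moreover have "(real j - real i) / (2 * real M) \<le> 1"
    using ij M by (simp add: divide_le_eq)
  ultimately show ?thesis using False by simp
qed

text \<open>The factor \<open>(s / (2 M))\<^sup>M\<close> is the volume of the box. Of the constant 16, the one-particle weights use 10,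
  the grid gaps use 4, and the denominators \<open>(2 M)\<^sup>M\<close> of the volume use 2.\<close>

lemma ensemble_weight_lower:
  assumes M: "1 \<le> M" "M \<le> N" and s: "0 < s" "s \<le> 1 / 2" "real N * s\<^sup>2 = real M"
    and x: "\<And>i. i \<in> {1..M} \<Longrightarrow> x i \<in> reference_cell M s i"
  shows "(2 / exp 1) ^ (N * M) * exp (- (16 * real (M * M))) * s ^ ((M div 2)\<^sup>2 + (M - M div 2)\<^sup>2)
       \<le> ensemble_weight N M x * (s / (2 * real M)) ^ M"
proof -
  define f where "f i j = (if i \<in> {1..M div 2} \<longleftrightarrow> j \<in> {1..M div 2} then s else 1)" for i j
  have f0: "0 \<le> f i j" for i j using s by (simp add: f_def)
  have site: "(2 / exp 1) ^ N * exp (- (10 * real M)) \<le> site_weight N M (x i)"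
    if i: "i \<in> {1..M}" for i
  proof -
    have "real i / real M \<le> 1" using i by auto
    then have "s * (real i / real M) \<le> s * 1"
      using s by (intro mult_left_mono) auto
    moreover have "s / (2 * real M) \<le> s / 2"
      using M s by (intro divide_left_mono) auto
    moreover have "0 \<le> s * real i / real M" using s by auto
    moreover have "sqrt 2 + s * real i / real M \<le> \<bar>x i\<bar>"
        "\<bar>x i\<bar> \<le> sqrt 2 + s * real i / real M + s / (2 * real M)"
      using reference_cell_abs(1)[OF M(1) s(1) x[OF i]] by auto
    ultimately have "sqrt 2 \<le> \<bar>x i\<bar>" "\<bar>x i\<bar> \<le> sqrt 2 + 2 * s"
      using s by (simp_all only: times_divide_eq_right)
    then show ?thesis
      using M s by (intro site_weight_lower)
  qed
  have "((2 / exp 1) ^ N * exp (- (10 * real M))) ^ M = (\<Prod>i=1..M. (2 / exp 1) ^ N * exp (- (10 * real M)))"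
    by simp
  also have "\<dots> \<le> (\<Prod>i=1..M. site_weight N M (x i))"
    by (intro prod_mono conjI site) auto
  finally have 1: "(2 / exp 1) ^ (N * M) * exp (- (10 * real (M * M))) \<le> (\<Prod>i=1..M. site_weight N M (x i))"
    by (simp add: power_mult_distrib exp_of_nat2_mult[symmetric] mult.assoc flip: power_mult)
  have "(\<Prod>(i, j)\<in>index_pairs M. f i j ^ 2) * exp (- (4 * real (M * M)))
      \<le> (\<Prod>(i, j)\<in>index_pairs M. f i j ^ 2)
         * (\<Prod>(i, j)\<in>index_pairs M. (real j - real i) / (2 * real M)) ^ 2"
  proof (intro mult_left_mono)
    have "exp (- (2 * real M * real M)) ^ 2
        \<le> (\<Prod>(i, j)\<in>index_pairs M. (real j - real i) / (2 * real M)) ^ 2"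
      using M by (intro power_mono prod_index_pairs_gap_lower) auto
    then show "exp (- (4 * real (M * M)))
        \<le> (\<Prod>(i, j)\<in>index_pairs M. (real j - real i) / (2 * real M)) ^ 2"
      by (simp add: exp_of_nat2_mult[symmetric] mult_ac)
  qed (auto intro!: prod_nonneg)
  also have "\<dots> = (\<Prod>(i, j)\<in>index_pairs M. (f i j * ((real j - real i) / (2 * real M))) ^ 2)"
    by (simp only: prod_power_distrib prod.distrib[symmetric] power_mult_distrib case_prod_unfold)
  also have "\<dots> \<le> (\<Prod>(i, j)\<in>index_pairs M. \<bar>x i - x j\<bar> ^ 2)"
  proof (intro prod_mono, clarify, intro conjI power_mono)
    fix i j assume ij: "1 \<le> i" "i < j" "j \<le> M"
    show "f i j * ((real j - real i) / (2 * real M)) \<le> \<bar>x i - x j\<bar>"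
      using reference_cell_distance[OF M(1) s(1,2) ij(2,3) x x] ij by (auto simp: f_def)
    show "0 \<le> f i j * ((real j - real i) / (2 * real M))"
      using f0 ij by (intro mult_nonneg_nonneg divide_nonneg_nonneg) auto
  qed auto
  finally have 2: "(\<Prod>(i, j)\<in>index_pairs M. f i j ^ 2) * exp (- (4 * real (M * M)))
      \<le> (\<Prod>(i, j)\<in>index_pairs M. \<bar>x i - x j\<bar> ^ 2)" .
  have "2 * real M \<le> exp (2 * real M)"
    using exp_ge_add_one_self[of "2 * real M"] by linarith
  then have "exp (- (2 * real M)) \<le> 1 / (2 * real M)"
    using M by (simp add: exp_minus field_simps)
  then have "s * exp (- (2 * real M)) \<le> s * (1 / (2 * real M))"
    using s by (intro mult_left_mono) auto
  then have "s * exp (- (2 * real M)) \<le> s / (2 * real M)"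
    by (simp only: times_divide_eq_right mult_1_right)
  then have "(s * exp (- (2 * real M))) ^ M \<le> (s / (2 * real M)) ^ M"
    using s by (intro power_mono) auto
  then have 3: "s ^ M * exp (- (2 * real (M * M))) \<le> (s / (2 * real M)) ^ M"
    by (simp add: power_mult_distrib exp_of_nat2_mult[symmetric] mult.assoc)
  have "s ^ ((M div 2)\<^sup>2 + (M - M div 2)\<^sup>2) = (\<Prod>(i, j)\<in>index_pairs M. f i j ^ 2) * s ^ M"
    unfolding f_def using prod_same_block[of "{1..M div 2}" M s] by auto
  moreover have "exp (- (16 * real (M * M)))
      = exp (- (10 * real (M * M))) * exp (- (4 * real (M * M))) * exp (- (2 * real (M * M)))"
    by (simp flip: exp_add)
  ultimately have "(2 / exp 1) ^ (N * M) * exp (- (16 * real (M * M))) * s ^ ((M div 2)\<^sup>2 + (M - M div 2)\<^sup>2)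
      = ((2 / exp 1) ^ (N * M) * exp (- (10 * real (M * M))))
        * ((\<Prod>(i, j)\<in>index_pairs M. f i j ^ 2) * exp (- (4 * real (M * M))))
        * (s ^ M * exp (- (2 * real (M * M))))"
    by simp
  also have "\<dots> \<le> (\<Prod>i=1..M. site_weight N M (x i)) * (\<Prod>(i, j)\<in>index_pairs M. \<bar>x i - x j\<bar> ^ 2)
        * (s / (2 * real M)) ^ M"
    using s by (intro mult_mono 1 2 3 mult_nonneg_nonneg prod_nonneg ballI site_weight_nonneg) auto
  finally show ?thesis unfolding ensemble_weight_eq .
qed

section \<open>Probabilities of rare configurations\<close>

text \<open>Since \<open>(\<bar>x\<bar> - sqrt 2)\<^sup>2 \<ge> x\<^sup>2 / 2 - 2\<close>, a centred normal density of variance 8 dominates the integrand up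
  to a constant.\<close>

lemma nn_integral_well_gaussian_le:
  "(\<integral>\<^sup>+x. ennreal (exp (- ((well_offset x)\<^sup>2 / 8))) \<partial>lborel) \<le> ennreal (exp 3)"
proof -
  have pos: "0 < sqrt (16 * pi)" by simp
  have sq: "sqrt (16 * pi) \<le> 8"
    using pi_less_4 by (intro real_le_lsqrt) auto
  have dens: "exp (- ((well_offset x)\<^sup>2 / 8)) \<le> exp (1/4) * sqrt (16 * pi) * normal_density 0 (sqrt 8) x" for x
  proof -
    have "0 \<le> (\<bar>x\<bar> - 2 * sqrt 2)\<^sup>2" by simp
    then have "x\<^sup>2 / 2 - 2 \<le> (well_offset x)\<^sup>2"
      by (simp add: power2_eq_square algebra_simps)
    then have "exp (- ((well_offset x)\<^sup>2 / 8)) \<le> exp (1 / 4 + - (x\<^sup>2 / 16))"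
      by simp
    also have "\<dots> = exp (1/4) * exp (- (x\<^sup>2 / 16))" by (rule exp_add)
    also have "exp (- (x\<^sup>2 / 16)) = sqrt (16 * pi) * normal_density 0 (sqrt 8) x"
      using pos by (simp add: normal_density_def mult.commute)
    finally show ?thesis by (simp only: mult.assoc)
  qed
  have "(\<integral>\<^sup>+x. ennreal (exp (- ((well_offset x)\<^sup>2 / 8))) \<partial>lborel)
      \<le> (\<integral>\<^sup>+x. ennreal (exp (1/4) * sqrt (16 * pi)) * ennreal (normal_density 0 (sqrt 8) x) \<partial>lborel)"
    using dens by (intro nn_integral_mono) (simp add: ennreal_mult[symmetric])
  also have "\<dots> = ennreal (exp (1/4) * sqrt (16 * pi)) * (\<integral>\<^sup>+x. ennreal (normal_density 0 (sqrt 8) x) \<partial>lborel)"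
    by (rule nn_integral_cmult) simp
  also have "(\<integral>\<^sup>+x. ennreal (normal_density 0 (sqrt 8) x) \<partial>lborel) = 1"
    by (subst nn_integral_eq_integral) auto
  also have "ennreal (exp (1/4) * sqrt (16 * pi)) * 1 \<le> ennreal (exp 3)"
  proof -
    have "(3/2) ^ 5 \<le> exp (1/2 :: real) ^ 5"
      using exp_ge_add_one_self[of "1/2"] by (intro power_mono) auto
    also have "\<dots> = exp (5/2)" by (simp flip: exp_of_nat_mult)
    finally have "(15/2 :: real) \<le> exp (5/2)" by (simp add: power_divide)
    moreover have "(5/4 :: real) \<le> exp (1/4)" using exp_ge_add_one_self[of "1/4 :: real"] by simp
    ultimately have "(15/2) * (5/4) \<le> exp (5/2) * exp (1/4 :: real)" by (intro mult_mono) auto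
    also have "\<dots> = exp (11/4)" by (simp flip: exp_add)
    finally have "8 \<le> exp (11/4 :: real)" by simp
    then have "exp (1/4) * sqrt (16 * pi) \<le> exp (1/4) * exp (11/4)"
      using sq by (intro mult_left_mono) auto
    also have "\<dots> = exp 3" by (simp flip: exp_add)
    finally show ?thesis by (simp add: ennreal_leI)
  qed
  finally show ?thesis .
qed

lemma emeasure_reference_box:
  assumes "1 \<le> M" "0 < s"
  shows "emeasure (\<Pi>\<^sub>M i\<in>{1..M}. lborel) (Pi\<^sub>E {1..M} (reference_cell M s))
       = ennreal ((s / (2 * real M)) ^ M)"
    and "Pi\<^sub>E {1..M} (reference_cell M s) \<in> sets (\<Pi>\<^sub>M i\<in>{1..M}. lborel)"
proof -
  interpret product_sigma_finite "\<lambda>_::nat. lborel :: real measure" ..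
  have cell: "reference_cell M s i \<in> sets lborel"
      "emeasure lborel (reference_cell M s i) = ennreal (s / (2 * real M))" for i
    using assms by (auto simp: reference_cell_def Let_def)
  show "emeasure (\<Pi>\<^sub>M i\<in>{1..M}. lborel) (Pi\<^sub>E {1..M} (reference_cell M s))
       = ennreal ((s / (2 * real M)) ^ M)"
    using assms by (subst emeasure_PiM) (simp_all add: cell ennreal_power del: sets_lborel)
  show "Pi\<^sub>E {1..M} (reference_cell M s) \<in> sets (\<Pi>\<^sub>M i\<in>{1..M}. lborel)"
    by (intro sets_PiM_I_finite cell) auto
qed

text \<open>The box of balanced configurations has probability at most 1, which bounds the unknown normalising
  constant from above. The pointwise upper bound then integrates over \<open>B\<close> as a product of one-particle
  integrals. The peak value \<open>(2 / e)\<^bsup>N M\<^esup>\<close> cancels. The constant 24 collects 16 from the box, 5 from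
  \<open>96 \<le> exp 5\<close>, and 3 from the Gaussian integral.\<close>

lemma ensemble_probability_le:
  assumes P: "prob_space P"
    and dens: "joint_density_proportional P {1..M} X (ensemble_weight N M)"
    and M: "1 \<le> M" "4 * M \<le> N" and s: "0 < s" "s \<le> 1 / 2" "real N * s\<^sup>2 = real M"
    and B: "B \<in> sets (\<Pi>\<^sub>M i\<in>{1..M}. lborel)" and R: "0 \<le> R"
    and bound: "\<And>x k. x \<in> B \<Longrightarrow> k = card {i \<in> {1..M}. x i \<ge> 0} \<Longrightarrow>
        s ^ (k\<^sup>2 + (M - k)\<^sup>2) * exp (- (real N / 8 * (\<Sum>i=1..M. (well_offset (x i))\<^sup>2))) \<le> R"
  shows "measure P {\<omega> \<in> space P. (\<lambda>i\<in>{1..M}. X i \<omega>) \<in> B}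
           * s ^ ((M div 2)\<^sup>2 + (M - M div 2)\<^sup>2 + M) \<le> exp (24 * real (M * M)) * R"
proof -
  interpret prob_space P by (rule P)
  interpret product_sigma_finite "\<lambda>_::nat. lborel :: real measure" ..
  let ?L = "\<Pi>\<^sub>M i\<in>{1..M}. lborel :: real measure"
  define T where "T \<omega> = (\<lambda>i\<in>{1..M}. X i \<omega>)" for \<omega>
  define A :: real where "A = (2 / exp 1) ^ (N * M)"
  define q where "q = (M div 2)\<^sup>2 + (M - M div 2)\<^sup>2"
  obtain c where c: "c > 0" and dist: "distributed P ?L T (\<lambda>x. ennreal (c * ensemble_weight N M x))"
    using dens unfolding joint_density_proportional_def T_def by blast
  have A: "A > 0" by (simp add: A_def)

  \<comment> \<open>Normalisation: the box has probability at most 1.\<close>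
  define Q where "Q = Pi\<^sub>E {1..M} (reference_cell M s)"
  define vol where "vol = (s / (2 * real M)) ^ M"
  have vol: "vol > 0" using s M by (simp add: vol_def)
  define low where "low = c * (A * exp (- (16 * real (M * M))) * s ^ q / vol)"
  have low: "low \<ge> 0" using A c s vol by (simp add: low_def)
  have Q: "Q \<in> sets ?L" "emeasure ?L Q = ennreal vol"
    unfolding Q_def vol_def using emeasure_reference_box[OF M(1) s(1)] by auto
  have low_le: "low \<le> c * ensemble_weight N M x" if "x \<in> Q" for x
  proof -
    have "A * exp (- (16 * real (M * M))) * s ^ q \<le> ensemble_weight N M x * vol"
      unfolding A_def q_def vol_def using that M
      by (intro ensemble_weight_lower s) (auto simp: Q_def PiE_iff)
    then show ?thesis
      unfolding low_def using c vol by (intro mult_left_mono) (auto simp: pos_divide_le_eq)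
  qed
  have "ennreal low * emeasure ?L Q = (\<integral>\<^sup>+x. ennreal low * indicator Q x \<partial>?L)"
    using Q by (simp add: nn_integral_cmult_indicator)
  also have "\<dots> \<le> (\<integral>\<^sup>+x. ennreal (c * ensemble_weight N M x) * indicator Q x \<partial>?L)"
    by (intro nn_integral_mono) (auto simp: indicator_def intro!: ennreal_leI low_le)
  also have "\<dots> = emeasure P (T -` Q \<inter> space P)"
    using distributed_emeasure[OF dist Q(1)] by simp
  also have "\<dots> \<le> 1" by (rule emeasure_le_1)
  finally have "low * vol \<le> 1"
    unfolding Q(2) using low vol by (simp add: ennreal_mult[symmetric])
  then have "c * A * exp (- (16 * real (M * M))) * s ^ q \<le> 1"
    using vol by (simp add: low_def mult.assoc)
  then have norm: "c * A * s ^ q \<le> exp (16 * real (M * M))"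
    by (simp add: exp_minus field_simps)

  \<comment> \<open>Numerator: integrate the pointwise upper bound over \<open>B\<close>.\<close>
  define up where "up = c * A * 96 ^ (M * M) * R / s ^ M"
  have up: "up \<ge> 0" using A c s R by (simp add: up_def)
  have le_up: "c * ensemble_weight N M x \<le> up * (\<Prod>i=1..M. exp (- ((well_offset (x i))\<^sup>2 / 8)))"
    if x: "x \<in> B" for x
  proof -
    define k where "k = card {i \<in> {1..M}. x i \<ge> 0}"
    let ?E = "exp (- (real N / 8 * (\<Sum>i=1..M. (well_offset (x i))\<^sup>2)))"
    let ?G = "\<Prod>i=1..M. exp (- ((well_offset (x i))\<^sup>2 / 8))"
    have G: "?G \<ge> 0" by (intro prod_nonneg) auto
    have "ensemble_weight N M x * s ^ M
        \<le> s ^ (k\<^sup>2 + (M - k)\<^sup>2) * (A * 96 ^ (M * M) * ?E * ?G)"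
      unfolding k_def A_def by (rule ensemble_weight_upper[OF M s(1,3)])
    also have "\<dots> = (s ^ (k\<^sup>2 + (M - k)\<^sup>2) * ?E) * (A * 96 ^ (M * M) * ?G)"
      by simp
    also have "\<dots> \<le> R * (A * 96 ^ (M * M) * ?G)"
      using A G by (intro mult_right_mono bound[OF x k_def]) auto
    finally have "c * (ensemble_weight N M x * s ^ M) \<le> c * (R * (A * 96 ^ (M * M) * ?G))"
      using c by (intro mult_left_mono) auto
    then show ?thesis
      unfolding up_def using s by (simp add: pos_le_divide_eq mult_ac)
  qed
  have "emeasure P (T -` B \<inter> space P)
      = (\<integral>\<^sup>+x. ennreal (c * ensemble_weight N M x) * indicator B x \<partial>?L)"
    by (rule distributed_emeasure[OF dist B])
  also have "\<dots> \<le> (\<integral>\<^sup>+x. ennreal up * (\<Prod>i=1..M. ennreal (exp (- ((well_offset (x i))\<^sup>2 / 8)))) \<partial>?L)"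
  proof (intro nn_integral_mono)
    fix x
    show "ennreal (c * ensemble_weight N M x) * indicator B x
        \<le> ennreal up * (\<Prod>i=1..M. ennreal (exp (- ((well_offset (x i))\<^sup>2 / 8))))"
      using le_up[of x] up
      by (auto simp: indicator_def prod_ennreal ennreal_mult[symmetric] prod_nonneg intro!: ennreal_leI)
  qed
  also have "\<dots> = ennreal up * (\<integral>\<^sup>+x. (\<Prod>i=1..M. ennreal (exp (- ((well_offset (x i))\<^sup>2 / 8)))) \<partial>?L)"
    by (intro nn_integral_cmult) measurable
  also have "(\<integral>\<^sup>+x. (\<Prod>i=1..M. ennreal (exp (- ((well_offset (x i))\<^sup>2 / 8)))) \<partial>?L)
      = (\<Prod>i=1..M. \<integral>\<^sup>+x. ennreal (exp (- ((well_offset x)\<^sup>2 / 8))) \<partial>lborel)"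
    by (rule product_nn_integral_prod) auto
  also have "\<dots> \<le> ennreal (exp 3) ^ M"
    using nn_integral_well_gaussian_le by (simp add: power_mono)
  finally have "emeasure P (T -` B \<inter> space P) \<le> ennreal (up * exp (3 * real M))"
    using up by (simp add: ennreal_mult ennreal_power exp_of_nat2_mult mult_left_mono)
  moreover have "T -` B \<inter> space P = {\<omega> \<in> space P. T \<omega> \<in> B}" by auto
  ultimately have p: "measure P {\<omega> \<in> space P. T \<omega> \<in> B} \<le> up * exp (3 * real M)"
    using up by (simp add: emeasure_eq_measure)

  \<comment> \<open>\<open>exp (1 / 6) \<ge> 7 / 6\<close>, and the thirtieth power of \<open>7 / 6\<close> exceeds 96.\<close>
  have "(7/6) ^ 30 \<le> exp (1/6 :: real) ^ 30"
    using exp_ge_add_one_self[of "1/6"] by (intro power_mono) auto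
  also have "\<dots> = exp 5" by (simp flip: exp_of_nat_mult)
  finally have "(96 :: real) \<le> exp 5" by (simp add: power_divide)
  then have "(96 :: real) ^ (M * M) \<le> exp 5 ^ (M * M)" by (intro power_mono) auto
  then have c96: "(96 :: real) ^ (M * M) \<le> exp (5 * real (M * M))" by (simp only: exp_of_nat2_mult)
  have c3: "exp (3 * real M) \<le> exp (3 * real (M * M))"
    using M by simp
  have "measure P {\<omega> \<in> space P. T \<omega> \<in> B} * s ^ (q + M) \<le> up * exp (3 * real M) * s ^ (q + M)"
    using p s by (intro mult_right_mono) auto
  also have "\<dots> = ((c * A * s ^ q) * 96 ^ (M * M) * exp (3 * real M)) * R"
    unfolding up_def using s by (simp add: power_add)
  also have "\<dots> \<le> (exp (16 * real (M * M)) * exp (5 * real (M * M)) * exp (3 * real (M * M))) * R"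
    using norm c96 c3 R c A s by (intro mult_right_mono mult_mono) auto
  also have "exp (16 * real (M * M)) * exp (5 * real (M * M)) * exp (3 * real (M * M)) = exp (24 * real (M * M))"
    by (simp flip: exp_add)
  finally show ?thesis unfolding T_def q_def .
qed

lemma measurable_card_Collect:
  fixes p :: "real \<Rightarrow> bool" and M :: nat
  assumes "{y. p y} \<in> sets borel"
  shows "(\<lambda>x. real (card {i \<in> {1..M}. p (x i)})) \<in> borel_measurable (\<Pi>\<^sub>M i\<in>{1..M}. lborel)"
proof -
  have "real (card {i \<in> {1..M}. p (x i)}) = (\<Sum>i=1..M. indicator {y. p y} (x i))" for x :: "nat \<Rightarrow> real"
    by (simp add: indicator_def sum.If_cases Int_def)
  moreover have "(\<lambda>x. \<Sum>i=1..M. indicator {y. p y} (x i) :: real) \<in> borel_measurable (\<Pi>\<^sub>M i\<in>{1..M}. lborel)"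
  proof (intro borel_measurable_sum)
    fix i assume "i \<in> {1..M}"
    then have "(\<lambda>x. x i) \<in> measurable (\<Pi>\<^sub>M i\<in>{1..M}. lborel) (lborel :: real measure)"
      by (rule measurable_component_singleton)
    then have "(\<lambda>x. x i) \<in> measurable (\<Pi>\<^sub>M i\<in>{1..M}. lborel) (borel :: real measure)"
      by (simp only: measurable_lborel1)
    from measurable_compose[OF this borel_measurable_indicator[OF assms]]
    show "(\<lambda>x. indicator {y. p y} (x i) :: real) \<in> borel_measurable (\<Pi>\<^sub>M i\<in>{1..M}. lborel)" .
  qed
  ultimately show ?thesis by (simp only:)
qed

lemma square_add_square_complement:
  assumes "k \<le> M"
  shows "real (k\<^sup>2 + (M - k)\<^sup>2) = (real M)\<^sup>2 / 2 + 2 * (real k - real M / 2)\<^sup>2"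
proof -
  have "real (M - k) = real M - real k" using assms by simp
  then show ?thesis
    by (simp only: of_nat_add of_nat_power) (simp add: power2_eq_square algebra_simps)
qed

lemma balanced_exponent_le: "real ((M div 2)\<^sup>2 + (M - M div 2)\<^sup>2) \<le> (real M)\<^sup>2 / 2 + 1 / 2"
proof -
  have "\<bar>real (M div 2) - real M / 2\<bar> \<le> 1 / 2"
    by (cases "even M") (auto elim!: evenE oddE)
  then have "(real (M div 2) - real M / 2)\<^sup>2 \<le> (1 / 2)\<^sup>2"
    by (rule power2_le_iff_abs_le[THEN iffD2, rotated]) simp
  then show ?thesis
    by (subst square_add_square_complement) (auto simp: power2_eq_square)
qed

text \<open>The bound of the lemma \<open>ensemble_probability_le\<close> on the logarithmic scale, with
  \<open>s = sqrt (M / N) = exp (- ln (N / M) / 2)\<close>. The common factor \<open>s\<^bsup>M\<^sup>2 / 2\<^esup>\<close> of the balanced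
  configurations cancels, which leaves the excess \<open>2 (k - M / 2)\<^sup>2\<close> and the cost of the offsets. The remaining
  \<open>M / 2 + 1 / 4\<close> comes from the volume factor \<open>s\<^sup>M\<close> and from odd \<open>M\<close>.\<close>

lemma ensemble_probability_le_exp:
  assumes P: "prob_space P"
    and dens: "joint_density_proportional P {1..M} X (ensemble_weight N M)"
    and M: "1 \<le> M" "4 * M \<le> N"
    and B: "B \<in> sets (\<Pi>\<^sub>M i\<in>{1..M}. lborel)"
    and bound: "\<And>x k. x \<in> B \<Longrightarrow> k = card {i \<in> {1..M}. x i \<ge> 0} \<Longrightarrow>
        - (2 * (real k - real M / 2)\<^sup>2 * (ln (real N / real M) / 2))
          - real N / 8 * (\<Sum>i=1..M. (well_offset (x i))\<^sup>2) \<le> - r"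
  shows "measure P {\<omega> \<in> space P. (\<lambda>i\<in>{1..M}. X i \<omega>) \<in> B}
           \<le> exp (24 * (real M)\<^sup>2 + (real M / 2 + 1 / 4) * ln (real N / real M) - r)"
proof -
  define \<l> where "\<l> = ln (real N / real M)"
  define s where "s = exp (- (\<l> / 2))"
  have N: "real N / real M \<ge> 4" using M by (simp add: pos_le_divide_eq)
  have \<l>: "\<l> \<ge> 0" using N by (simp add: \<l>_def)
  have s2: "s\<^sup>2 = real M / real N"
  proof -
    have "s\<^sup>2 = exp (- \<l>)" by (simp add: s_def exp_of_nat_mult[symmetric])
    also have "\<dots> = real M / real N" using N M by (simp add: \<l>_def exp_minus)
    finally show ?thesis .
  qed
  have s: "0 < s" "s \<le> 1 / 2" "real N * s\<^sup>2 = real M"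
  proof -
    show "0 < s" by (simp add: s_def)
    have "s\<^sup>2 \<le> (1 / 2)\<^sup>2"
      unfolding s2 using M by (simp add: power2_eq_square pos_divide_le_eq)
    then show "s \<le> 1 / 2" by (rule power2_le_imp_le) simp
    show "real N * s\<^sup>2 = real M" unfolding s2 using M by simp
  qed
  have spow: "s ^ n = exp (- (real n * \<l> / 2))" for n
    by (simp add: s_def exp_of_nat_mult[symmetric])
  let ?p = "measure P {\<omega> \<in> space P. (\<lambda>i\<in>{1..M}. X i \<omega>) \<in> B}"
  let ?q = "(M div 2)\<^sup>2 + (M - M div 2)\<^sup>2 + M"
  define R where "R = exp (- ((real M)\<^sup>2 / 2 * (\<l> / 2)) - r)"
  have "?p * s ^ ?q \<le> exp (24 * real (M * M)) * R"
  proof (rule ensemble_probability_le[OF P dens M s B])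
    show "0 \<le> R" by (simp add: R_def)
  next
    fix x k assume x: "x \<in> B" and k: "k = card {i \<in> {1..M}. x i \<ge> 0}"
    have "{i \<in> {1..M}. x i \<ge> 0} \<subseteq> {1..M}" by auto
    from card_mono[OF _ this] have "k \<le> M" unfolding k by simp
    then have "s ^ (k\<^sup>2 + (M - k)\<^sup>2) = exp (- (((real M)\<^sup>2 / 2 + 2 * (real k - real M / 2)\<^sup>2) * \<l> / 2))"
      unfolding spow by (subst square_add_square_complement) auto
    then have "s ^ (k\<^sup>2 + (M - k)\<^sup>2) * exp (- (real N / 8 * (\<Sum>i=1..M. (well_offset (x i))\<^sup>2)))
        = exp (- ((real M)\<^sup>2 / 2 * (\<l> / 2)) + (- (2 * (real k - real M / 2)\<^sup>2 * (\<l> / 2))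
           - real N / 8 * (\<Sum>i=1..M. (well_offset (x i))\<^sup>2)))"
      by (simp add: exp_add[symmetric] add_divide_distrib distrib_right)
    also have "\<dots> \<le> R"
      using bound[OF x k] unfolding R_def \<l>_def by simp
    finally show "s ^ (k\<^sup>2 + (M - k)\<^sup>2) * exp (- (real N / 8 * (\<Sum>i=1..M. (well_offset (x i))\<^sup>2))) \<le> R" .
  qed
  moreover have "?p * exp (- (((real M)\<^sup>2 / 2 + 1 / 2 + real M) * \<l> / 2)) \<le> ?p * s ^ ?q"
  proof (intro mult_left_mono)
    have "real ?q * \<l> \<le> ((real M)\<^sup>2 / 2 + 1 / 2 + real M) * \<l>"
      using balanced_exponent_le[of M] \<l> by (intro mult_right_mono) auto
    then show "exp (- (((real M)\<^sup>2 / 2 + 1 / 2 + real M) * \<l> / 2)) \<le> s ^ ?q"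
      unfolding spow by simp
  qed simp
  ultimately have "?p * exp (- (((real M)\<^sup>2 / 2 + 1 / 2 + real M) * \<l> / 2)) \<le> exp (24 * real (M * M)) * R"
    by (rule order_trans[rotated])
  then have "?p \<le> exp (24 * real (M * M)) * R * exp (((real M)\<^sup>2 / 2 + 1 / 2 + real M) * \<l> / 2)"
    by (simp only: exp_minus) (simp add: field_simps)
  also have "\<dots> = exp (24 * (real M)\<^sup>2 + (real M / 2 + 1 / 4) * \<l> - r)"
    unfolding R_def exp_add[symmetric] by (simp add: power2_eq_square algebra_simps)
  finally show ?thesis unfolding \<l>_def .
qed

lemma imbalance_probability_le:
  assumes P: "prob_space P"
    and dens: "joint_density_proportional P {1..M} X (ensemble_weight N M)"
    and M: "1 \<le> M" "4 * M \<le> N" and \<epsilon>: "0 < \<epsilon>"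
  defines "E \<equiv> {\<omega> \<in> space P. \<epsilon> * real M \<le> \<bar>real (card {i \<in> {1..M}. X i \<omega> \<ge> 0}) - real M / 2\<bar>}"
  shows "E \<in> sets P"
    and "measure P E \<le> exp (24 * (real M)\<^sup>2
           - (\<epsilon>\<^sup>2 * (real M)\<^sup>2 - real M / 2 - 1 / 4) * ln (real N / real M))"
proof -
  let ?L = "\<Pi>\<^sub>M i\<in>{1..M}. lborel :: real measure"
  define B where "B = {x \<in> space ?L. \<epsilon> * real M \<le> \<bar>real (card {i \<in> {1..M}. x i \<ge> 0}) - real M / 2\<bar>}"
  have T: "(\<lambda>\<omega>. \<lambda>i\<in>{1..M}. X i \<omega>) \<in> measurable P ?L"
    using dens unfolding joint_density_proportional_def by (blast dest: distributed_measurable)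
  have [measurable]: "(\<lambda>x. real (card {i \<in> {1..M}. x i \<ge> 0})) \<in> borel_measurable ?L"
    by (rule measurable_card_Collect) simp
  have B: "B \<in> sets ?L" unfolding B_def by measurable
  have "{i \<in> {1..M}. (\<lambda>i\<in>{1..M}. X i \<omega>) i \<ge> 0} = {i \<in> {1..M}. X i \<omega> \<ge> 0}" for \<omega>
    by auto
  then have E: "E = {\<omega> \<in> space P. (\<lambda>i\<in>{1..M}. X i \<omega>) \<in> B}"
    using measurable_space[OF T] unfolding E_def B_def by auto
  also have "\<dots> = (\<lambda>\<omega>. \<lambda>i\<in>{1..M}. X i \<omega>) -` B \<inter> space P" by auto
  finally show "E \<in> sets P" using measurable_sets[OF T B] by simp
  have \<l>: "ln (real N / real M) \<ge> 0" using M by (intro ln_ge_zero) (simp add: pos_le_divide_eq)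
  have "measure P E \<le> exp (24 * (real M)\<^sup>2 + (real M / 2 + 1 / 4) * ln (real N / real M)
      - \<epsilon>\<^sup>2 * (real M)\<^sup>2 * ln (real N / real M))"
    unfolding E
  proof (rule ensemble_probability_le_exp[OF P dens M B])
    fix x k assume x: "x \<in> B" and k: "k = card {i \<in> {1..M}. x i \<ge> 0}"
    have "(\<epsilon> * real M)\<^sup>2 \<le> \<bar>real k - real M / 2\<bar>\<^sup>2"
      using x \<epsilon> unfolding B_def k by (intro power_mono) auto
    then have "\<epsilon>\<^sup>2 * (real M)\<^sup>2 * ln (real N / real M) \<le> (real k - real M / 2)\<^sup>2 * ln (real N / real M)"
      using \<l> by (intro mult_right_mono) (auto simp: power_mult_distrib)
    moreover have "0 \<le> real N / 8 * (\<Sum>i=1..M. (well_offset (x i))\<^sup>2)"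
      by (intro mult_nonneg_nonneg sum_nonneg) auto
    ultimately show "- (2 * (real k - real M / 2)\<^sup>2 * (ln (real N / real M) / 2))
          - real N / 8 * (\<Sum>i=1..M. (well_offset (x i))\<^sup>2) \<le> - (\<epsilon>\<^sup>2 * (real M)\<^sup>2 * ln (real N / real M))"
      by simp
  qed
  then show "measure P E \<le> exp (24 * (real M)\<^sup>2
           - (\<epsilon>\<^sup>2 * (real M)\<^sup>2 - real M / 2 - 1 / 4) * ln (real N / real M))"
    by (simp add: algebra_simps)
qed

text \<open>Each outlier contributes at least \<open>\<delta>\<^sup>2\<close> to the sum of squared offsets. The excess
  \<open>2 (k - M / 2)\<^sup>2\<close> of an unbalanced configuration only helps and is dropped.\<close>

lemma outlier_probability_le:
  fixes \<epsilon> \<delta> :: real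
  assumes P: "prob_space P"
    and dens: "joint_density_proportional P {1..M} X (ensemble_weight N M)"
    and M: "1 \<le> M" "4 * M \<le> N" and \<delta>: "0 < \<delta>"
  defines "E \<equiv> {\<omega> \<in> space P. \<epsilon> * real M \<le> real (card {i \<in> {1..M}. \<delta> \<le> \<bar>well_offset (X i \<omega>)\<bar>})}"
  shows "E \<in> sets P"
    and "measure P E \<le> exp (24 * (real M)\<^sup>2 - real N * real M * (\<epsilon> * \<delta>\<^sup>2 / 8)
           + (real M)\<^sup>2 * ln (real N / real M))"
proof -
  let ?L = "\<Pi>\<^sub>M i\<in>{1..M}. lborel :: real measure"
  define B where "B = {x \<in> space ?L. \<epsilon> * real M \<le> real (card {i \<in> {1..M}. \<delta> \<le> \<bar>well_offset (x i)\<bar>})}"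
  have T: "(\<lambda>\<omega>. \<lambda>i\<in>{1..M}. X i \<omega>) \<in> measurable P ?L"
    using dens unfolding joint_density_proportional_def by (blast dest: distributed_measurable)
  have [measurable]: "(\<lambda>x. real (card {i \<in> {1..M}. \<delta> \<le> \<bar>well_offset (x i)\<bar>})) \<in> borel_measurable ?L"
    by (rule measurable_card_Collect) measurable
  have B: "B \<in> sets ?L" unfolding B_def by measurable
  have "{i \<in> {1..M}. \<delta> \<le> \<bar>well_offset ((\<lambda>i\<in>{1..M}. X i \<omega>) i)\<bar>} = {i \<in> {1..M}. \<delta> \<le> \<bar>well_offset (X i \<omega>)\<bar>}" for \<omega>
    by auto
  then have E: "E = {\<omega> \<in> space P. (\<lambda>i\<in>{1..M}. X i \<omega>) \<in> B}"
    using measurable_space[OF T] unfolding E_def B_def by auto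
  also have "\<dots> = (\<lambda>\<omega>. \<lambda>i\<in>{1..M}. X i \<omega>) -` B \<inter> space P" by auto
  finally show "E \<in> sets P" using measurable_sets[OF T B] by simp
  have \<l>: "ln (real N / real M) \<ge> 0" using M by (intro ln_ge_zero) (simp add: pos_le_divide_eq)
  have "measure P E \<le> exp (24 * (real M)\<^sup>2 + (real M / 2 + 1 / 4) * ln (real N / real M)
      - real N * real M * (\<epsilon> * \<delta>\<^sup>2 / 8))"
    unfolding E
  proof (rule ensemble_probability_le_exp[OF P dens M B])
    fix x k assume x: "x \<in> B" and k: "k = card {i \<in> {1..M}. x i \<ge> 0}"
    define O' where "O' = {i \<in> {1..M}. \<delta> \<le> \<bar>well_offset (x i)\<bar>}"
    have "\<epsilon> * real M * \<delta>\<^sup>2 \<le> real (card O') * \<delta>\<^sup>2"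
      using x unfolding B_def O'_def by (intro mult_right_mono) auto
    also have "\<dots> = (\<Sum>i\<in>O'. \<delta>\<^sup>2)" by simp
    also have "\<dots> \<le> (\<Sum>i\<in>O'. \<bar>well_offset (x i)\<bar>\<^sup>2)"
      using \<delta> by (intro sum_mono power_mono) (auto simp: O'_def)
    also have "\<dots> = (\<Sum>i\<in>O'. (well_offset (x i))\<^sup>2)" by (simp only: power2_abs)
    also have "\<dots> \<le> (\<Sum>i=1..M. (well_offset (x i))\<^sup>2)"
      by (intro sum_mono2) (auto simp: O'_def)
    finally have "real N / 8 * (\<epsilon> * real M * \<delta>\<^sup>2) \<le> real N / 8 * (\<Sum>i=1..M. (well_offset (x i))\<^sup>2)"
      by (intro mult_left_mono) auto
    moreover have "0 \<le> 2 * (real k - real M / 2)\<^sup>2 * (ln (real N / real M) / 2)"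
      using \<l> by (intro mult_nonneg_nonneg) auto
    moreover have "real N / 8 * (\<epsilon> * real M * \<delta>\<^sup>2) = real N * real M * (\<epsilon> * \<delta>\<^sup>2 / 8)" by simp
    ultimately show "- (2 * (real k - real M / 2)\<^sup>2 * (ln (real N / real M) / 2))
          - real N / 8 * (\<Sum>i=1..M. (well_offset (x i))\<^sup>2) \<le> - (real N * real M * (\<epsilon> * \<delta>\<^sup>2 / 8))"
      by linarith
  qed
  also have "\<dots> \<le> exp (24 * (real M)\<^sup>2 - real N * real M * (\<epsilon> * \<delta>\<^sup>2 / 8)
           + (real M)\<^sup>2 * ln (real N / real M))"
  proof -
    have "real M * 1 \<le> real M * real M" using M by (intro mult_left_mono) auto
    then have "real M / 2 + 1 / 4 \<le> (real M)\<^sup>2"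
      using M unfolding power2_eq_square by linarith
    then have "(real M / 2 + 1 / 4) * ln (real N / real M) \<le> (real M)\<^sup>2 * ln (real N / real M)"
      using \<l> by (intro mult_right_mono)
    then show ?thesis by simp
  qed
  finally show "measure P E \<le> exp (24 * (real M)\<^sup>2 - real N * real M * (\<epsilon> * \<delta>\<^sup>2 / 8)
           + (real M)\<^sup>2 * ln (real N / real M))" .
qed

section \<open>From particle counts to weak convergence\<close>

lemma cdf_dirac_sum:
  assumes "finite I" "c \<ge> 0"
  shows "cdf (dirac_sum c I x) y = c * real (card {i \<in> I. x i \<le> y})"
proof -
  have "emeasure (dirac_sum c I x) {..y} = (\<Sum>i\<in>I. ennreal (c * indicator {..y} (x i)))"
    unfolding emeasure_dirac_sum[OF assms(1) atMost_borel]
    by (intro sum.cong refl) (simp add: indicator_def)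
  also have "\<dots> = ennreal (\<Sum>i\<in>I. c * indicator {..y} (x i))"
    using assms by (intro sum_ennreal) auto
  also have "(\<Sum>i\<in>I. c * indicator {..y} (x i)) = c * real (card {i \<in> I. x i \<le> y})"
    using assms by (simp add: sum_distrib_left[symmetric] indicator_def sum.If_cases Int_def)
  finally show ?thesis
    using assms by (simp add: cdf_def measure_def)
qed

text \<open>The limit distribution function is discontinuous at the two wells, so only points \<open>y\<close> at some distance
  \<open>\<delta> > 0\<close> from both matter. Below \<open>y\<close> lie, up to particles at distance at least \<open>\<delta>\<close> from the wells, no
  particles, the negative ones, or all of them, according to the position of \<open>y\<close>.\<close>

lemma weak_conv_m_two_wells:
  fixes M :: "nat \<Rightarrow> nat" and l :: "nat \<Rightarrow> nat \<Rightarrow> real"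
  assumes M: "\<forall>\<^sub>F N in sequentially. 1 \<le> M N"
    and half: "(\<lambda>N. real (card {i \<in> {1..M N}. l N i < 0}) / real (M N)) \<longlonglongrightarrow> 1 / 2"
    and out: "\<And>\<delta>. \<delta> > 0 \<Longrightarrow>
      (\<lambda>N. real (card {i \<in> {1..M N}. \<delta> \<le> \<bar>well_offset (l N i)\<bar>}) / real (M N)) \<longlonglongrightarrow> 0"
  shows "weak_conv_m (\<lambda>N. empirical_measure (M N) (l N)) (dirac_sum (1 / 2) {- sqrt 2, sqrt 2} (\<lambda>x. x))"
proof -
  let ?\<mu> = "dirac_sum (1 / 2) {- sqrt 2, sqrt 2} (\<lambda>x. x)"
  have ne: "- sqrt 2 \<noteq> sqrt (2::real)"
    by (metis less_irrefl neg_less_0_iff_less order.strict_trans real_sqrt_gt_zero zero_less_numeral)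
  have "emeasure ?\<mu> UNIV = (\<Sum>i\<in>{- sqrt 2, sqrt 2}. ennreal (1 / 2))"
    by (simp add: emeasure_dirac_sum)
  then have "finite_measure ?\<mu>"
    by (intro finite_measureI) (simp add: dirac_sum_def ennreal_mult_eq_top_iff)
  then interpret \<mu>: finite_borel_measure ?\<mu>
    by (intro finite_borel_measure.intro finite_borel_measure_axioms.intro) (auto simp: dirac_sum_def)
  have cdf_lim: "(\<lambda>N. cdf (empirical_measure (M N) (l N)) y) \<longlonglongrightarrow> cdf ?\<mu> y"
    if y: "isCont (cdf ?\<mu>) y" for y
  proof -
    have y2: "y \<noteq> sqrt 2" "y \<noteq> - sqrt 2"
    proof -
      have "emeasure ?\<mu> {a} \<ge> ennreal (1 / 2)" if "a \<in> {- sqrt 2, sqrt 2}" for a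
        using that ne by (auto simp: emeasure_dirac_sum indicator_def)
      then have "measure ?\<mu> {a} \<noteq> 0" if "a \<in> {- sqrt 2, sqrt 2}" for a
        using that \<mu>.emeasure_eq_measure[of "{a}"] by fastforce
      then show "y \<noteq> sqrt 2" "y \<noteq> - sqrt 2"
        using y unfolding \<mu>.isCont_cdf by auto
    qed
    define \<delta> where "\<delta> = min \<bar>y - sqrt 2\<bar> \<bar>y + sqrt 2\<bar>"
    have \<delta>: "\<delta> > 0" using y2 by (auto simp: \<delta>_def)
    \<comment> \<open>\<open>V N\<close> is the set that \<open>F N\<close> would be if every particle were close to the well on its side.\<close>
    define V where "V N = {i \<in> {1..M N}. sqrt 2 < y \<or> - sqrt 2 < y \<and> l N i < 0}" for N
    define Far where "Far N = {i \<in> {1..M N}. \<delta> \<le> \<bar>well_offset (l N i)\<bar>}" for N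
    define F where "F N = {i \<in> {1..M N}. l N i \<le> y}" for N
    have fin: "finite (V N)" "finite (Far N)" "finite (F N)" for N
      by (auto simp: V_def Far_def F_def)
    have "F N \<subseteq> V N \<union> Far N" "V N \<subseteq> F N \<union> Far N" for N
      using y2 by (auto simp: V_def Far_def F_def \<delta>_def abs_if min_def split: if_splits)
    then have "card (F N) \<le> card (V N) + card (Far N)" "card (V N) \<le> card (F N) + card (Far N)" for N
      by (meson card_Un_le card_mono fin finite_UnI le_trans)+
    from this[THEN of_nat_mono[where 'a = real]]
    have close: "\<bar>real (card (F N)) - real (card (V N))\<bar> \<le> real (card (Far N))" for N
      by (simp add: abs_le_iff algebra_simps)
    have "(\<lambda>N. real (card (F N)) / real (M N) - real (card (V N)) / real (M N)) \<longlonglongrightarrow> 0"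
    proof (rule Lim_null_comparison)
      show "(\<lambda>N. real (card (Far N)) / real (M N)) \<longlonglongrightarrow> 0"
        unfolding Far_def by (rule out[OF \<delta>])
      show "\<forall>\<^sub>F N in sequentially. norm (real (card (F N)) / real (M N) - real (card (V N)) / real (M N))
          \<le> real (card (Far N)) / real (M N)"
        using close by (intro always_eventually allI) (auto simp: diff_divide_distrib[symmetric] intro: divide_right_mono)
    qed
    moreover have "(\<lambda>N. real (card (V N)) / real (M N)) \<longlonglongrightarrow> cdf ?\<mu> y"
    proof -
      consider "y < - sqrt 2" | "- sqrt 2 < y" "y < sqrt 2" | "sqrt 2 < y"
        using y2 by linarith
      then show ?thesis
      proof cases
        case 1
        then have y': "y < sqrt 2" using real_sqrt_gt_zero[of 2] by linarith
        have "{i \<in> {- sqrt 2, sqrt 2}. i \<le> y} = {}" using 1 y' by auto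
        then have "cdf ?\<mu> y = 0" by (simp add: cdf_dirac_sum del: Collect_empty_eq)
        moreover have "V N = {}" for N using 1 y' by (auto simp: V_def)
        ultimately show ?thesis by simp
      next
        case 2
        have "{i \<in> {- sqrt 2, sqrt 2}. i \<le> y} = {- sqrt 2}" using 2 by auto
        then have "cdf ?\<mu> y = 1 / 2" by (simp add: cdf_dirac_sum)
        moreover have "V N = {i \<in> {1..M N}. l N i < 0}" for N using 2 by (auto simp: V_def)
        ultimately show ?thesis using half by (simp only:)
      next
        case 3
        then have y': "- sqrt 2 < y" using real_sqrt_gt_zero[of 2] by linarith
        have "{i \<in> {- sqrt 2, sqrt 2}. i \<le> y} = {- sqrt 2, sqrt 2}" using 3 y' by auto
        then have "cdf ?\<mu> y = 1" using ne by (simp add: cdf_dirac_sum)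
        moreover have "V N = {1..M N}" for N using 3 by (auto simp: V_def)
        then have "\<forall>\<^sub>F N in sequentially. real (card (V N)) / real (M N) = 1"
          by (intro eventually_mono[OF M]) auto
        ultimately show ?thesis by (simp add: tendsto_eventually)
      qed
    qed
    ultimately have "(\<lambda>N. real (card (F N)) / real (M N)) \<longlonglongrightarrow> cdf ?\<mu> y"
      by (rule Lim_transform[rotated])
    then show ?thesis
      by (simp add: empirical_measure_def cdf_dirac_sum F_def)
  qed
  then show ?thesis
    unfolding weak_conv_m_def weak_conv_def by blast
qed

section \<open>Almost sure convergence\<close>

text \<open>First Borel--Cantelli lemma, for events that need to be measurable and rare only from some index on.\<close>

lemma AE_eventually_not_of_summable:
  assumes P: "prob_space P"
    and bound: "\<forall>\<^sub>F N in sequentially. {\<omega> \<in> space P. E N \<omega>} \<in> sets P \<and>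
        measure P {\<omega> \<in> space P. E N \<omega>} \<le> b N"
    and b: "summable b" "\<And>N. 0 \<le> b N"
  shows "AE \<omega> in P. \<forall>\<^sub>F N in sequentially. \<not> E N \<omega>"
proof -
  interpret prob_space P by (rule P)
  define A where "A N = {\<omega> \<in> space P. E N \<omega>}" for N
  define G where "G N \<longleftrightarrow> A N \<in> sets P \<and> measure P (A N) \<le> b N" for N
  define A' where "A' N = (if G N then A N else {})" for N
  have G: "\<forall>\<^sub>F N in sequentially. G N" using bound by (simp add: G_def A_def)
  have "AE \<omega> in P. \<forall>\<^sub>F N in sequentially. \<omega> \<in> space P - A' N"
  proof (rule borel_cantelli_AE1)
    show "A' N \<in> sets P" for N by (simp add: A'_def G_def)
    show "emeasure P (A' N) < \<infinity>" for N by (simp add: emeasure_eq_measure)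
    show "summable (\<lambda>N. measure P (A' N))"
      by (rule summable_comparison_test'[OF b(1), of 0]) (auto simp: A'_def G_def b)
  qed
  then show ?thesis
  proof (rule AE_mp, intro AE_I2 impI)
    fix \<omega> assume "\<omega> \<in> space P" "\<forall>\<^sub>F N in sequentially. \<omega> \<in> space P - A' N"
    from this(2) G show "\<forall>\<^sub>F N in sequentially. \<not> E N \<omega>"
      by eventually_elim (auto simp: A'_def A_def)
  qed
qed

text \<open>To be used with \<open>\<l> = ln (N / M)\<close>, so that \<open>ln M + \<l> = ln N\<close>. The term \<open>e M\<^sup>2 \<l>\<close> has to dominate three others:
  \<open>24 M\<^sup>2\<close> because \<open>\<l>\<close> is large, \<open>M \<l>\<close> because \<open>M\<close> is large, and \<open>ln N\<close> because \<open>M\<close> and \<open>\<l>\<close> are both at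
  most \<open>M \<l>\<close>. The last point covers every growth rate of \<open>M\<close>, down to extremely slow growth.\<close>

lemma imbalance_exponent:
  fixes M \<l> e :: real
  assumes "e > 0" "1 \<le> M" "16 \<le> M * e" "1 \<le> \<l>" "96 \<le> e * \<l>"
  shows "24 * M\<^sup>2 - (e * M\<^sup>2 - M / 2 - 1 / 4) * \<l> \<le> - 2 * (ln M + \<l>)"
proof -
  have a: "16 * M \<le> e * M\<^sup>2"
    using mult_right_mono[OF assms(3), of M] assms by (simp add: power2_eq_square mult_ac)
  have b: "96 * M\<^sup>2 \<le> e * M\<^sup>2 * \<l>"
    using mult_right_mono[OF assms(5), of "M\<^sup>2"] by (simp add: mult_ac)
  have "16 * M * \<l> \<le> e * M\<^sup>2 * \<l>" using a assms by (intro mult_right_mono) auto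
  then have c: "16 * (M * \<l>) \<le> e * M\<^sup>2 * \<l>" by (simp only: mult.assoc)
  have d: "(M / 2 + 1 / 4) * \<l> \<le> M * \<l>" using assms by (intro mult_right_mono) auto
  have f: "1 * \<l> \<le> M * \<l>" "M * 1 \<le> M * \<l>" using assms by (auto intro!: mult_mono)
  have g: "ln M \<le> M" using assms ln_le_minus_one[of M] by simp
  have "24 * y - (x - z) \<le> - 2 * (L + \<l>)"
    if "16 * w \<le> x" "z \<le> w" "1 * \<l> \<le> w" "M * 1 \<le> w" "L \<le> M" "96 * y \<le> x" for w x y z L
    using that assms(2) by simp
  from this[OF c d f g b] show ?thesis
    by (simp add: algebra_simps)
qed

text \<open>Also for \<open>\<l> = ln (N / M)\<close>: half of the gain \<open>N M c\<close> absorbs the terms of order \<open>M\<^sup>2\<close> and \<open>M\<^sup>2 \<l>\<close>, which are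
  smaller by factors of order \<open>M / N\<close> and \<open>(M / N) ln (N / M)\<close>. The other half yields summability.\<close>

lemma outlier_exponent:
  fixes M N \<l> c :: real
  assumes "1 \<le> M" "0 < N" "24 * (M / N) + (M / N) * \<l> \<le> c / 2" "2 * ln N \<le> c / 2 * N" "0 < c"
  shows "24 * M\<^sup>2 - N * M * c + M\<^sup>2 * \<l> \<le> - 2 * ln N"
proof -
  have "24 * M\<^sup>2 + M\<^sup>2 * \<l> = (N * M) * (24 * (M / N) + (M / N) * \<l>)"
    using assms by (simp add: power2_eq_square field_simps)
  also have "\<dots> \<le> (N * M) * (c / 2)" using assms by (intro mult_left_mono) auto
  finally have "24 * M\<^sup>2 + M\<^sup>2 * \<l> \<le> (N * M) * (c / 2)" .
  moreover have "1 * (c / 2 * N) \<le> M * (c / 2 * N)"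
    using assms by (intro mult_right_mono) auto
  ultimately show ?thesis using assms(4) by (simp add: algebra_simps)
qed

lemma AE_fraction_nonneg_tendsto_half:
  fixes P :: "'a measure" and M :: "nat \<Rightarrow> nat" and lam :: "nat \<Rightarrow> nat \<Rightarrow> 'a \<Rightarrow> real"
  assumes P: "prob_space P"
    and M: "filterlim M at_top sequentially" "(\<lambda>N. real (M N) / real N) \<longlonglongrightarrow> 0"
    and dens: "\<And>N. N \<ge> 1 \<Longrightarrow> joint_density_proportional P {1..M N} (lam N) (ensemble_weight N (M N))"
  shows "AE \<omega> in P. (\<lambda>N. real (card {i \<in> {1..M N}. lam N i \<omega> \<ge> 0}) / real (M N)) \<longlonglongrightarrow> 1 / 2"
proof -
  define C where "C N \<omega> = real (card {i \<in> {1..M N}. lam N i \<omega> \<ge> 0})" for N \<omega>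
  define E where "E \<epsilon> N \<omega> \<longleftrightarrow> \<epsilon> * real (M N) \<le> \<bar>C N \<omega> - real (M N) / 2\<bar>" for \<epsilon> N \<omega>
  have M1: "\<forall>\<^sub>F N in sequentially. 1 \<le> M N"
    using M(1) by (simp add: filterlim_at_top)
  have rare: "AE \<omega> in P. \<forall>\<^sub>F N in sequentially. \<not> E \<epsilon> N \<omega>" if \<epsilon>: "\<epsilon> > 0" for \<epsilon>
  proof (rule AE_eventually_not_of_summable[OF P])
    show "summable (\<lambda>N. 1 / real N ^ 2)"
      using inverse_power_summable[of 2, where 'a = real] by (simp add: inverse_eq_divide)
    have "\<forall>\<^sub>F N in sequentially. real (M N) / real N < min (1 / 4) (exp (- max 1 (96 / \<epsilon>\<^sup>2)))"
      by (rule order_tendstoD(2)[OF M(2)]) simp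
    moreover have "\<forall>\<^sub>F N in sequentially. nat \<lceil>16 / \<epsilon>\<^sup>2\<rceil> \<le> M N"
      using M(1) unfolding filterlim_at_top by blast
    ultimately show "\<forall>\<^sub>F N in sequentially. {\<omega> \<in> space P. E \<epsilon> N \<omega>} \<in> sets P \<and>
        measure P {\<omega> \<in> space P. E \<epsilon> N \<omega>} \<le> 1 / real N ^ 2"
      using M1 eventually_ge_at_top[of "1::nat"]
    proof eventually_elim
      case (elim N)
      then have N: "1 \<le> N" and M: "1 \<le> M N" and r: "real (M N) / real N < 1 / 4"
        and r': "real (M N) / real N < exp (- max 1 (96 / \<epsilon>\<^sup>2))" by auto
      have MN: "4 * M N \<le> N" using r N by (simp add: pos_divide_less_eq)
      define \<l> where "\<l> = ln (real N / real (M N))"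
      have "exp (- \<l>) = real (M N) / real N"
        using M N by (simp add: \<l>_def exp_minus)
      with r' have "exp (- \<l>) < exp (- max 1 (96 / \<epsilon>\<^sup>2))" by simp
      then have l: "max 1 (96 / \<epsilon>\<^sup>2) \<le> \<l>"
        by (simp only: exp_less_cancel_iff neg_less_iff_less less_imp_le)
      then have "96 / \<epsilon>\<^sup>2 \<le> \<l>" by simp
      then have l96: "96 \<le> \<epsilon>\<^sup>2 * \<l>" using \<epsilon> by (simp add: pos_divide_le_eq mult.commute)
      have "16 / \<epsilon>\<^sup>2 \<le> real (M N)" using elim by linarith
      then have M16: "16 \<le> real (M N) * \<epsilon>\<^sup>2" using \<epsilon> by (simp add: pos_divide_le_eq)
      have lnN: "ln (real (M N)) + \<l> = ln (real N)"
        using M N by (simp add: \<l>_def ln_div)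
      note tail = imbalance_probability_le[OF P dens[OF N] M MN \<epsilon>]
      have "measure P {\<omega> \<in> space P. E \<epsilon> N \<omega>}
          \<le> exp (24 * (real (M N))\<^sup>2 - (\<epsilon>\<^sup>2 * (real (M N))\<^sup>2 - real (M N) / 2 - 1 / 4) * \<l>)"
        unfolding E_def C_def \<l>_def by (rule tail(2))
      also have "\<dots> \<le> exp (- 2 * (ln (real (M N)) + \<l>))"
        using \<epsilon> M M16 l l96 by (intro exp_le_cancel_iff[THEN iffD2] imbalance_exponent) auto
      also have "\<dots> = 1 / real N ^ 2"
      proof -
        have "exp (- 2 * ln (real N)) = inverse (exp (ln (real N)) ^ 2)"
          by (simp add: exp_minus exp_of_nat_mult[symmetric])
        then show ?thesis unfolding lnN using N by (simp add: inverse_eq_divide)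
      qed
      finally show ?case using tail(1) unfolding E_def C_def by blast
    qed
  qed simp
  then have "AE \<omega> in P. \<forall>n. \<forall>\<^sub>F N in sequentially. \<not> E (1 / real (Suc n)) N \<omega>"
    by (subst AE_all_countable) (intro allI rare, simp)
  then show ?thesis
  proof (rule AE_mp, intro AE_I2 impI)
    fix \<omega> assume ev: "\<forall>n. \<forall>\<^sub>F N in sequentially. \<not> E (1 / real (Suc n)) N \<omega>"
    have "(\<lambda>N. C N \<omega> / real (M N)) \<longlonglongrightarrow> 1 / 2"
    proof (rule tendstoI)
      fix e :: real assume "e > 0"
      then obtain n where n: "1 / real (Suc n) < e"
        by (metis inverse_eq_divide reals_Archimedean)
      from M1 ev[rule_format, of n] show "\<forall>\<^sub>F N in sequentially. dist (C N \<omega> / real (M N)) (1 / 2) < e"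
      proof eventually_elim
        case (elim N)
        then have "\<bar>C N \<omega> - real (M N) / 2\<bar> < 1 / real (Suc n) * real (M N)" by (simp add: E_def)
        then have "\<bar>C N \<omega> - real (M N) / 2\<bar> / real (M N) < 1 / real (Suc n)"
          using elim by (simp add: pos_divide_less_eq)
        also have "\<bar>C N \<omega> - real (M N) / 2\<bar> / real (M N) = \<bar>(C N \<omega> - real (M N) / 2) / real (M N)\<bar>"
          by (simp only: abs_divide abs_of_nat)
        also have "(C N \<omega> - real (M N) / 2) / real (M N) = C N \<omega> / real (M N) - 1 / 2"
          using elim by (simp add: diff_divide_distrib)
        finally show ?case using n by (simp add: dist_real_def)
      qed
    qed
    then show "(\<lambda>N. real (card {i \<in> {1..M N}. lam N i \<omega> \<ge> 0}) / real (M N)) \<longlonglongrightarrow> 1 / 2"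
      unfolding C_def .
  qed
qed

lemma AE_fraction_outliers_tendsto_0:
  fixes P :: "'a measure" and M :: "nat \<Rightarrow> nat" and lam :: "nat \<Rightarrow> nat \<Rightarrow> 'a \<Rightarrow> real"
  assumes P: "prob_space P"
    and M: "filterlim M at_top sequentially" "(\<lambda>N. real (M N) / real N) \<longlonglongrightarrow> 0"
    and dens: "\<And>N. N \<ge> 1 \<Longrightarrow> joint_density_proportional P {1..M N} (lam N) (ensemble_weight N (M N))"
  shows "AE \<omega> in P. \<forall>\<delta>>0.
    (\<lambda>N. real (card {i \<in> {1..M N}. \<delta> \<le> \<bar>well_offset (lam N i \<omega>)\<bar>}) / real (M N)) \<longlonglongrightarrow> 0"
proof -
  define C where "C \<delta> N \<omega> = card {i \<in> {1..M N}. \<delta> \<le> \<bar>well_offset (lam N i \<omega>)\<bar>}" for \<delta> N \<omega>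
  define E where "E \<epsilon> N \<omega> \<longleftrightarrow> \<epsilon> * real (M N) \<le> real (C \<epsilon> N \<omega>)" for \<epsilon> N \<omega>
  have M1: "\<forall>\<^sub>F N in sequentially. 1 \<le> M N"
    using M(1) by (simp add: filterlim_at_top)
  have rare: "AE \<omega> in P. \<forall>\<^sub>F N in sequentially. \<not> E \<epsilon> N \<omega>" if \<epsilon>: "\<epsilon> > 0" for \<epsilon>
  proof (rule AE_eventually_not_of_summable[OF P])
    \<comment> \<open>The same \<open>\<epsilon>\<close> bounds the fraction of outliers and their distance, so one sequence suffices.\<close>
    define c where "c = \<epsilon> * \<epsilon>\<^sup>2 / 8"
    have c: "c > 0" using \<epsilon> by (simp add: c_def)
    show "summable (\<lambda>N. 1 / real N ^ 2)"
      using inverse_power_summable[of 2, where 'a = real] by (simp add: inverse_eq_divide)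
    have "\<forall>\<^sub>F N in sequentially. real (M N) / real N < 1 / 4"
      by (rule order_tendstoD(2)[OF M(2)]) simp
    moreover have "\<forall>\<^sub>F N in sequentially. 24 * (real (M N) / real N) + (real (M N) / real N) * ln (real N / real (M N)) \<le> c / 2"
    proof -
      have "((\<lambda>t::real. 24 * t + t * ln (inverse t)) \<longlongrightarrow> 0) (at_right 0)"
        by real_asymp
      moreover have "filterlim (\<lambda>N. real (M N) / real N) (at_right 0) sequentially"
        unfolding filterlim_at
      proof
        show "\<forall>\<^sub>F N in sequentially. real (M N) / real N \<in> {0<..} \<and> real (M N) / real N \<noteq> 0"
          using M1 eventually_ge_at_top[of "1::nat"] by eventually_elim auto
      qed (rule M(2))
      ultimately have "(\<lambda>N. 24 * (real (M N) / real N) + real (M N) / real N * ln (inverse (real (M N) / real N))) \<longlonglongrightarrow> 0"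
        by (rule filterlim_compose)
      from order_tendstoD(2)[OF this, of "c / 2"] c show ?thesis
        by (auto elim!: eventually_mono)
    qed
    moreover have "\<forall>\<^sub>F N in sequentially. 2 * ln (real N) \<le> c / 2 * real N"
      using c by real_asymp
    ultimately show "\<forall>\<^sub>F N in sequentially. {\<omega> \<in> space P. E \<epsilon> N \<omega>} \<in> sets P \<and>
        measure P {\<omega> \<in> space P. E \<epsilon> N \<omega>} \<le> 1 / real N ^ 2"
      using M1 eventually_ge_at_top[of "1::nat"]
    proof eventually_elim
      case (elim N)
      then have N: "1 \<le> N" and M: "1 \<le> M N" and r: "real (M N) / real N < 1 / 4" by auto
      have MN: "4 * M N \<le> N" using r N by (simp add: pos_divide_less_eq)
      note tail = outlier_probability_le[OF P dens[OF N] M MN \<epsilon>, of \<epsilon>]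
      have "measure P {\<omega> \<in> space P. E \<epsilon> N \<omega>}
          \<le> exp (24 * (real (M N))\<^sup>2 - real N * real (M N) * c + (real (M N))\<^sup>2 * ln (real N / real (M N)))"
        unfolding E_def C_def c_def by (rule tail(2))
      also have "\<dots> \<le> exp (- 2 * ln (real N))"
        using elim c by (intro exp_le_cancel_iff[THEN iffD2] outlier_exponent) auto
      also have "\<dots> = inverse (exp (ln (real N)) ^ 2)"
        by (simp add: exp_minus exp_of_nat_mult[symmetric])
      also have "\<dots> = 1 / real N ^ 2" using N by (simp add: inverse_eq_divide)
      finally show ?case using tail(1) unfolding E_def C_def by blast
    qed
  qed simp
  then have "AE \<omega> in P. \<forall>n. \<forall>\<^sub>F N in sequentially. \<not> E (1 / real (Suc n)) N \<omega>"
    by (subst AE_all_countable) (intro allI rare, simp)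
  then show ?thesis
  proof (rule AE_mp, intro AE_I2 impI allI)
    fix \<omega> \<delta> assume ev: "\<forall>n. \<forall>\<^sub>F N in sequentially. \<not> E (1 / real (Suc n)) N \<omega>" and \<delta>: "(\<delta>::real) > 0"
    have "(\<lambda>N. real (C \<delta> N \<omega>) / real (M N)) \<longlonglongrightarrow> 0"
    proof (rule tendstoI)
      fix e :: real assume "e > 0"
      then have "min e \<delta> > 0" using \<delta> by simp
      then obtain n where "1 / real (Suc n) < min e \<delta>"
        by (metis inverse_eq_divide reals_Archimedean)
      then have n: "1 / real (Suc n) < e" "1 / real (Suc n) \<le> \<delta>" by auto
      from M1 ev[rule_format, of n] show "\<forall>\<^sub>F N in sequentially. dist (real (C \<delta> N \<omega>) / real (M N)) 0 < e"
      proof eventually_elim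
        case (elim N)
        have "real (C \<delta> N \<omega>) \<le> real (C (1 / real (Suc n)) N \<omega>)"
          unfolding C_def using n(2) by (intro of_nat_mono card_mono) auto
        also have "\<dots> < 1 / real (Suc n) * real (M N)" using elim by (simp add: E_def)
        finally have "real (C \<delta> N \<omega>) / real (M N) < 1 / real (Suc n)"
          using elim by (simp add: pos_divide_less_eq)
        then show ?case using n(1) by (simp add: dist_real_def)
      qed
    qed
    then show "(\<lambda>N. real (card {i \<in> {1..M N}. \<delta> \<le> \<bar>well_offset (lam N i \<omega>)\<bar>}) / real (M N)) \<longlonglongrightarrow> 0"
      unfolding C_def .
  qed
qed

theorem corollary3p4:
  fixes P :: "'a measure"
    and M :: "nat \<Rightarrow> nat"
    and lam :: "nat \<Rightarrow> nat \<Rightarrow> 'a \<Rightarrow> real"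
    and \<Theta> :: "nat \<Rightarrow> real"
  assumes "prob_space P"
    and "\<And>N. N \<ge> 1 \<Longrightarrow> 1 \<le> M N \<and> M N \<le> N"
    and "filterlim M at_top sequentially"
    and "(\<lambda>N. real (M N) / real N) \<longlonglongrightarrow> 0"
    and "\<And>N. N \<ge> 1 \<Longrightarrow>
           joint_density_proportional P {1..M N} (lam N) (ensemble_weight N (M N))"
    and "\<And>N. N \<ge> 1 \<Longrightarrow> \<Theta> N > 0"
    and "\<Theta> \<longlonglongrightarrow> 0"
    and "\<And>N. N \<ge> 1 \<Longrightarrow>
           real (M N) ^ 2 * ln (\<Theta> N powi (-2)) = real N * real (M N) * \<Theta> N ^ 2"
  shows "(AE \<omega> in P. (\<lambda>N. mass (mu_alpha (M N) (\<Theta> N) (\<lambda>i. lam N i \<omega>))) \<longlonglongrightarrow> 1 / 2)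
       \<and> (AE \<omega> in P. (\<lambda>N. mass (mu_beta (M N) (\<Theta> N) (\<lambda>i. lam N i \<omega>))) \<longlonglongrightarrow> 1 / 2)
       \<and> (AE \<omega> in P. weak_conv_m (\<lambda>N. empirical_measure (M N) (\<lambda>i. lam N i \<omega>))
             (dirac_sum (1 / 2) {- sqrt 2, sqrt 2} (\<lambda>x. x)))"
proof -
  define a where "a N \<omega> = real (card {i \<in> {1..M N}. lam N i \<omega> \<ge> 0}) / real (M N)" for N \<omega>
  define b where "b N \<omega> = real (card {i \<in> {1..M N}. lam N i \<omega> < 0}) / real (M N)" for N \<omega>
  have M1: "\<forall>\<^sub>F N in sequentially. 1 \<le> M N"
    using assms(3) by (simp add: filterlim_at_top)
  have alpha: "AE \<omega> in P. (\<lambda>N. a N \<omega>) \<longlonglongrightarrow> 1 / 2"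
    unfolding a_def by (rule AE_fraction_nonneg_tendsto_half[OF assms(1,3,4,5)])
  have beta_of_alpha: "(\<lambda>N. b N \<omega>) \<longlonglongrightarrow> 1 / 2" if "(\<lambda>N. a N \<omega>) \<longlonglongrightarrow> 1 / 2" for \<omega>
  proof -
    have "(\<lambda>N. 1 - a N \<omega>) \<longlonglongrightarrow> 1 - 1 / 2"
      using that by (intro tendsto_diff tendsto_const)
    moreover have "\<forall>\<^sub>F N in sequentially. 1 - a N \<omega> = b N \<omega>"
      using M1
    proof eventually_elim
      case (elim N)
      have "{1..M N} = {i \<in> {1..M N}. lam N i \<omega> \<ge> 0} \<union> {i \<in> {1..M N}. lam N i \<omega> < 0}" by auto
      then have "card {1..M N} = card {i \<in> {1..M N}. lam N i \<omega> \<ge> 0} + card {i \<in> {1..M N}. lam N i \<omega> < 0}"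
        by (metis (no_types, lifting) card_Un_disjoint disjoint_iff finite_Un finite_atLeastAtMost
            mem_Collect_eq not_less)
      then have "real (M N) = real (card {i \<in> {1..M N}. lam N i \<omega> \<ge> 0}) + real (card {i \<in> {1..M N}. lam N i \<omega> < 0})"
        by (metis card_atLeastAtMost diff_Suc_1 of_nat_add)
      then show ?case using elim unfolding a_def b_def by (simp add: field_simps)
    qed
    ultimately show ?thesis using Lim_transform_eventually by fastforce
  qed
  have beta: "AE \<omega> in P. (\<lambda>N. b N \<omega>) \<longlonglongrightarrow> 1 / 2"
    using alpha by (rule AE_mp) (intro AE_I2 impI beta_of_alpha)
  have outliers: "AE \<omega> in P. \<forall>\<delta>>0.
      (\<lambda>N. real (card {i \<in> {1..M N}. \<delta> \<le> \<bar>well_offset (lam N i \<omega>)\<bar>}) / real (M N)) \<longlonglongrightarrow> 0"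
    by (rule AE_fraction_outliers_tendsto_0[OF assms(1,3,4,5)])
  have "AE \<omega> in P. weak_conv_m (\<lambda>N. empirical_measure (M N) (\<lambda>i. lam N i \<omega>))
             (dirac_sum (1 / 2) {- sqrt 2, sqrt 2} (\<lambda>x. x))"
    using beta outliers
  proof eventually_elim
    case (elim \<omega>)
    show ?case
      by (rule weak_conv_m_two_wells[OF M1]) (use elim in \<open>auto simp: b_def\<close>)
  qed
  moreover have "mass (mu_alpha (M N) (\<Theta> N) (\<lambda>i. lam N i \<omega>)) = a N \<omega>"
      "mass (mu_beta (M N) (\<Theta> N) (\<lambda>i. lam N i \<omega>)) = b N \<omega>" for N \<omega>
    by (simp_all add: mu_alpha_def mu_beta_def mass_dirac_sum a_def b_def)
  ultimately show ?thesis using alpha beta by simp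
qed

end
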